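(* Let $q\ge1$ be an integer and let $F$ be a graph containing a component $C$ with $|V(C)|<|E(C)|$. Then, as $n\to\infty$, $$\mathrm{ex}(n,F,q)\ge \left[q^2-\left(q-\left\lceil \tfrac{q+1}{2}\right\rceil +1\right)^2\frac{1}{\chi_1(F)-1}+o(1)\right]\binom{n}{2}.$$ In particular, if $\chi(F)=\chi_1(F)$, then $$\mathrm{ex}(n,F,q)= \left[q^2-\left(q-\left\lceil \tfrac{q+1}{2}\right\rceil +1\right)^2\frac{1}{\chi(F)-1}+o(1)\right]\binom{n}{2}.$$
   Context: All graphs are finite and simple; $\chi$ is the ordinary chromatic number. Let $n,q\ge 1$ be integers. For $\mathbf{x}\in\{0,1,\dots,q\}^n$ the support is $S_{\mathbf{x}}=\{i: x_i\neq 0\}$. Let $Q(n,2)=\{\mathbf{x}\in\{0,1,\dots,q\}^n: |S_{\mathbf{x}}|=2\}$; its elements are called $q$-edges, and a $q$-graph on $n$ vertices is a subset $H\subseteq Q(n,2)$. For a graph $F$ without isolated vertices and an integer $s\ge1$, a $q$-graph $H$ is an $s$-copy of $F$ if $|H|=|E(F)|$ and there is an isomorphism $\iota$ from $F$ to the graph with vertex set $\bigcup_{\mathbf{x}\in H}S_{\mathbf{x}}$ and edge set $\{S_{\mathbf{x}}:\mathbf{x}\in H\}$ such that, writing $\mathbf{x}^e$ for the unique element of $H$ with support $\iota(e)$, for all distinct $e,e'\in E(F)$ and $v\in e\cap e'$ we have $x^{e}_{\iota(v)}+x^{e'}_{\iota(v)}\ge s$. If $F$ has isolated vertices, $H\subseteq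 Q(n,2)$ is an $s$-copy of $F$ if $n\ge |V(F)|$ and $H$ is an $s$-copy of the subgraph of $F$ induced by its non-isolated vertices. A $q$-graph contains an $s$-copy of $F$ if some subset of it is an $s$-copy of $F$. $\mathrm{ex}(n,F,q)$ is the maximum of $|H|$ over all $H\subseteq Q(n,2)$ containing no $(q+1)$-copy of $F$. A 1-selection of a graph $F$ is a mapping $f$ assigning to each (non-isolated) vertex $v$ of $F$ an edge $f(v)\in E(F)$ with $v\in f(v)$ (nothing is assigned to isolated vertices). The 1-removed graph $F_f$ has vertex set $V(F)$ and edge set $E(F)$ minus the image of $f$. The 1-robust chromatic number is $\chi_1(F)=\min_f\chi(F_f)$, the minimum over all 1-selections $f$ of $F$. *)

theory Defs
  imports Complex_Main "HOL-Library.FuncSet" "HOL-Library.Landau_Symbols"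
begin

text \<open>A finite simple graph is given by a vertex set V and a set E of two-element subsets of V.
  The non-isolated vertices are therefore exactly the elements of \<open>\<Union>E\<close>.\<close>

definition simple_graph :: "'a set \<Rightarrow> 'a set set \<Rightarrow> bool" where
  "simple_graph V E \<longleftrightarrow> finite V \<and> (\<forall>e\<in>E. e \<subseteq> V \<and> card e = 2)"

definition adj_rel :: "'a set set \<Rightarrow> ('a \<times> 'a) set" where
  "adj_rel E = {(u, v). {u, v} \<in> E}"

definition components :: "'a set \<Rightarrow> 'a set set \<Rightarrow> 'a set set" where
  "components V E = {{v \<in> V. (u, v) \<in> (adj_rel E)\<^sup>*} | u. u \<in> V}"

definition induced_edges :: "'a set set \<Rightarrow> 'a set \<Rightarrow> 'a set set" where
  "induced_edges E C = {e \<in> E. e \<subseteq> C}"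

definition proper_coloring :: "'a set \<Rightarrow> 'a set set \<Rightarrow> nat \<Rightarrow> ('a \<Rightarrow> nat) \<Rightarrow> bool" where
  "proper_coloring V E k c \<longleftrightarrow> c \<in> V \<rightarrow> {..<k} \<and> (\<forall>u v. {u, v} \<in> E \<longrightarrow> c u \<noteq> c v)"

definition chromatic_number :: "'a set \<Rightarrow> 'a set set \<Rightarrow> nat" where
  "chromatic_number V E = (LEAST k. \<exists>c. proper_coloring V E k c)"

definition graph_iso ::
    "'a set \<Rightarrow> 'a set set \<Rightarrow> 'b set \<Rightarrow> 'b set set \<Rightarrow> ('a \<Rightarrow> 'b) \<Rightarrow> bool" where
  "graph_iso V E V' E' \<iota> \<longleftrightarrow> bij_betw \<iota> V V' \<and>
     (\<forall>u\<in>V. \<forall>v\<in>V. {u, v} \<in> E \<longleftrightarrow> {\<iota> u, \<iota> v} \<in> E')"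

definition one_selection :: "'a set set \<Rightarrow> ('a \<Rightarrow> 'a set) \<Rightarrow> bool" where
  "one_selection E f \<longleftrightarrow> (\<forall>v\<in>\<Union>E. f v \<in> E \<and> v \<in> f v)"

definition one_removed :: "'a set set \<Rightarrow> ('a \<Rightarrow> 'a set) \<Rightarrow> 'a set set" where
  "one_removed E f = E - f ` \<Union>E"

text \<open>The infimum of a set of natural numbers is its least element whenever it is non-empty, and
  every simple graph has a 1-selection.\<close>

definition robust_chromatic_number :: "'a set \<Rightarrow> 'a set set \<Rightarrow> nat" where
  "robust_chromatic_number V E =
     (INF f \<in> {f. one_selection E f}. chromatic_number V (one_removed E f))"

text \<open>A vector in \<open>{0,\<dots>,q}\<^sup>n\<close> is an extensional function on \<open>{1..n}\<close>.\<close>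

definition supp :: "nat \<Rightarrow> (nat \<Rightarrow> nat) \<Rightarrow> nat set" where
  "supp n x = {i \<in> {1..n}. x i \<noteq> 0}"

definition q_edges :: "nat \<Rightarrow> nat \<Rightarrow> (nat \<Rightarrow> nat) set" where
  "q_edges q n = {x \<in> {1..n} \<rightarrow>\<^sub>E {0..q}. card (supp n x) = 2}"

text \<open>\<open>edge_with_supp n H d\<close> is only used when H has exactly one element with support d:
  in the next definition, \<open>card H = card E\<close> and the isomorphism make the map sending an element of
  H to its support injective.\<close>

definition edge_with_supp :: "nat \<Rightarrow> (nat \<Rightarrow> nat) set \<Rightarrow> nat set \<Rightarrow> (nat \<Rightarrow> nat)" where
  "edge_with_supp n H d = (THE x. x \<in> H \<and> supp n x = d)"

definition s_copy_no_isolated ::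
    "nat \<Rightarrow> nat \<Rightarrow> 'a set \<Rightarrow> 'a set set \<Rightarrow> (nat \<Rightarrow> nat) set \<Rightarrow> bool" where
  "s_copy_no_isolated n s V E H \<longleftrightarrow> card H = card E \<and>
     (\<exists>\<iota>. graph_iso V E (\<Union>x\<in>H. supp n x) (supp n ` H) \<iota> \<and>
       (\<forall>e\<in>E. \<forall>e'\<in>E. \<forall>v\<in>e \<inter> e'. e \<noteq> e' \<longrightarrow>
          edge_with_supp n H (\<iota> ` e) (\<iota> v) + edge_with_supp n H (\<iota> ` e') (\<iota> v) \<ge> s))"

definition s_copy ::
    "nat \<Rightarrow> nat \<Rightarrow> nat \<Rightarrow> 'a set \<Rightarrow> 'a set set \<Rightarrow> (nat \<Rightarrow> nat) set \<Rightarrow> bool" where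
  "s_copy q n s V E H \<longleftrightarrow> H \<subseteq> q_edges q n \<and>
     (V \<noteq> \<Union>E \<longrightarrow> card V \<le> n) \<and> s_copy_no_isolated n s (\<Union>E) E H"

definition contains_s_copy ::
    "nat \<Rightarrow> nat \<Rightarrow> nat \<Rightarrow> 'a set \<Rightarrow> 'a set set \<Rightarrow> (nat \<Rightarrow> nat) set \<Rightarrow> bool" where
  "contains_s_copy q n s V E H \<longleftrightarrow> (\<exists>H'\<subseteq>H. s_copy q n s V E H')"

text \<open>As soon as the graph has an edge, the empty q-graph contains no copy of it, so that the
  maximum is over a non-empty finite set.\<close>

definition ex_number :: "nat \<Rightarrow> 'a set \<Rightarrow> 'a set set \<Rightarrow> nat \<Rightarrow> nat" where
  "ex_number n V E q =
     Max {card H | H. H \<subseteq> q_edges q n \<and> \<not> contains_s_copy q n (q + 1) V E H}"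

end

theory Submission
  imports Defs "HOL-Analysis.Convex"
begin

text \<open>Put \<open>m = \<lfloor>q/2\<rfloor> + 1\<close>, which equals \<open>\<lceil>(q+1)/2\<rceil>\<close>, and call an entry of a q-edge big if it is at
  least \<open>m\<close>. Two big entries always sum to at least \<open>q + 1\<close>, two entries that are not big never do.
  A pair of vertices carries \<open>q\<^sup>2\<close> q-edges, of which \<open>w = (q - \<lfloor>q/2\<rfloor>)\<^sup>2\<close> have both entries big.

  Lower bound. With \<open>t = \<chi>\<^sub>1(F) - 1\<close>, which is positive because a 1-selection cannot use all edges of
  the component \<open>C\<close>, split the vertices into residue classes modulo \<open>t\<close> and take all q-edges, except
  those inside a class with both entries big. In a \<open>(q+1)\<close>-copy of F every vertex has at most one
  edge with a small entry at it, and every edge inside a class has a small entry. A 1-selection that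
  picks the small edge at each vertex therefore removes all edges inside classes, and the classes
  colour what remains with \<open>t\<close> colours, a contradiction (\<open>turan_q_graph_copy_free\<close>). At most a fraction
  \<open>1/t\<close> of all pairs lies inside classes (\<open>card_congruent_pairs_le\<close>), so the bound holds for
  every \<open>n\<close> without any error term.

  Upper bound. In a q-graph without \<open>(q+1)\<close>-copy of F, the pairs that carry a q-edge with both entries
  big form an ordinary F-free graph. By the Erdos--Stone theorem it has at most
  \<open>(1 - 1/(\<chi>(F) - 1) + o(1))\<close> of all pairs, and every other pair misses \<open>w\<close> q-edges. For
  \<open>\<chi>(F) = \<chi>\<^sub>1(F)\<close> this meets the lower bound.

  The Erdos--Stone theorem (\<open>erdos_stone\<close>) is obtained by supersaturation: the Moon--Moser inequality
  forces a graph with edge density above \<open>1 - 1/r\<close> to have a positive proportion of all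
  \<open>(r+1)\<close>-subsets as cliques, and a positive proportion of all lists of length \<open>k\<close> contains a product of
  \<open>k\<close> sets of prescribed size (\<open>large_set_of_lists_contains_box\<close>). Applied to the vertex lists of
  cliques, this product is a complete \<open>(r+1)\<close>-partite graph.\<close>

section \<open>Counting cliques in dense graphs\<close>

definition cliques :: "'v set \<Rightarrow> 'v set set \<Rightarrow> nat \<Rightarrow> 'v set set" where
  "cliques A G k = {K. K \<subseteq> A \<and> card K = k \<and> (\<forall>u\<in>K. \<forall>v\<in>K. u \<noteq> v \<longrightarrow> {u, v} \<in> G)}"

definition common_neighbours :: "'v set \<Rightarrow> 'v set set \<Rightarrow> 'v set \<Rightarrow> 'v set" where
  "common_neighbours A G K = {v \<in> A - K. \<forall>u\<in>K. {u, v} \<in> G}"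

lemma finite_cliques: "finite A \<Longrightarrow> finite (cliques A G k)"
  unfolding cliques_def by (rule finite_subset[of _ "Pow A"]) auto

lemma finite_clique: "finite A \<Longrightarrow> K \<in> cliques A G k \<Longrightarrow> finite K"
  unfolding cliques_def by (auto intro: finite_subset)

lemma finite_common_neighbours: "finite A \<Longrightarrow> finite (common_neighbours A G K)"
  unfolding common_neighbours_def by auto

lemma insert_in_cliques:
  assumes "finite A" "B \<in> cliques A G k" "v \<in> common_neighbours A G B"
  shows "insert v B \<in> cliques A G (Suc k)"
  using assms finite_clique[OF assms(1,2)]
  unfolding cliques_def common_neighbours_def by (auto simp: insert_commute)

lemma remove_from_cliques:
  assumes "finite A" "K \<in> cliques A G (Suc k)" "v \<in> K"
  shows "K - {v} \<in> cliques A G k" "v \<in> common_neighbours A G (K - {v})"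
  using assms finite_clique[OF assms(1,2)]
  unfolding cliques_def common_neighbours_def by (auto simp: insert_commute)

text \<open>Removing a vertex from a clique of size \<open>k + 1\<close> yields the same pairs as choosing a clique of size
  \<open>k\<close> together with one of its common neighbours; both sides sum \<open>g\<close> over these pairs.\<close>

lemma sum_cliques_remove:
  fixes g :: "'v set \<Rightarrow> real"
  assumes "finite A"
  shows "(\<Sum>K\<in>cliques A G (Suc k). \<Sum>v\<in>K. g (K - {v}))
       = (\<Sum>B\<in>cliques A G k. real (card (common_neighbours A G B)) * g B)"
proof -
  have "(\<Sum>K\<in>cliques A G (Suc k). \<Sum>v\<in>K. g (K - {v}))
      = (\<Sum>(K, v)\<in>Sigma (cliques A G (Suc k)) (\<lambda>K. K). g (K - {v}))"
    by (rule sum.Sigma) (auto simp: finite_cliques assms intro: finite_clique[OF assms])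
  also have "\<dots> = (\<Sum>(B, v)\<in>Sigma (cliques A G k) (common_neighbours A G). g B)"
    by (rule sum.reindex_bij_witness[where i = "\<lambda>(B, v). (insert v B, v)"
          and j = "\<lambda>(K, v). (K - {v}, v)"])
       (auto intro: insert_in_cliques remove_from_cliques assms
             simp: common_neighbours_def insert_absorb)
  also have "\<dots> = (\<Sum>B\<in>cliques A G k. \<Sum>v\<in>common_neighbours A G B. g B)"
    by (rule sum.Sigma[symmetric]) (auto simp: finite_cliques finite_common_neighbours assms)
  finally show ?thesis by simp
qed

lemma card_cliques_Suc:
  assumes "finite A"
  shows "real (Suc k) * real (card (cliques A G (Suc k)))
       = (\<Sum>B\<in>cliques A G k. real (card (common_neighbours A G B)))"
proof -
  have "(\<Sum>K\<in>cliques A G (Suc k). \<Sum>v\<in>K. (1::real)) = (\<Sum>K\<in>cliques A G (Suc k). real (Suc k))"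
    by (rule sum.cong) (auto simp: cliques_def)
  then show ?thesis using sum_cliques_remove[OF assms, of "\<lambda>_. 1" G k] by (simp add: mult.commute)
qed

text \<open>Count, for each vertex \<open>x\<close>, the \<open>v \<in> K\<close> such that \<open>x\<close> is adjacent to all of \<open>K - {v}\<close>. If \<open>x\<close> is a
  common neighbour of \<open>K\<close>, every \<open>v\<close> counts. Otherwise at most one does: \<open>x\<close> itself if \<open>x \<in> K\<close>, and else
  the only non-neighbour of \<open>x\<close> in \<open>K\<close>.\<close>

lemma sum_common_neighbours_remove_le:
  assumes "finite A" "K \<in> cliques A G (Suc k)"
  shows "(\<Sum>v\<in>K. card (common_neighbours A G (K - {v})))
       \<le> k * card (common_neighbours A G K) + card A"
proof -
  let ?D = "common_neighbours A G"
  have finK: "finite K" and cK: "card K = Suc k" using finite_clique[OF assms] assms(2) by (auto simp: cliques_def)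
  have count: "card {v\<in>K. x \<in> ?D (K - {v})} \<le> k * of_bool (x \<in> ?D K) + 1" if x: "x \<in> A" for x
  proof (cases "x \<in> ?D K")
    case True
    then show ?thesis using card_mono[OF finK, of "{v\<in>K. x \<in> ?D (K - {v})}"] cK by auto
  next
    case False
    have "card {v\<in>K. x \<in> ?D (K - {v})} \<le> 1"
    proof (rule card_le_Suc0_iff_eq[THEN iffD2, unfolded One_nat_def[symmetric]])
      show "\<forall>v\<in>{v\<in>K. x \<in> ?D (K - {v})}. \<forall>w\<in>{v\<in>K. x \<in> ?D (K - {v})}. v = w"
        using False x unfolding common_neighbours_def by blast
    qed (use finK in auto)
    then show ?thesis by simp
  qed
  have "(\<Sum>v\<in>K. card (?D (K - {v}))) = (\<Sum>v\<in>K. \<Sum>x\<in>A. of_bool (x \<in> ?D (K - {v})))"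
    by (rule sum.cong) (auto simp: common_neighbours_def assms(1) intro!: arg_cong[where f=card])
  also have "\<dots> = (\<Sum>x\<in>A. \<Sum>v\<in>K. of_bool (x \<in> ?D (K - {v})))" by (rule sum.swap)
  also have "\<dots> = (\<Sum>x\<in>A. card {v\<in>K. x \<in> ?D (K - {v})})"
    using finK by (intro sum.cong) (auto intro!: arg_cong[where f=card])
  also have "\<dots> \<le> (\<Sum>x\<in>A. k * of_bool (x \<in> ?D K) + 1)"
    by (rule sum_mono) (rule count)
  also have "\<dots> = k * card (?D K) + card A"
  proof -
    have "A \<inter> {x. x \<in> ?D K} = ?D K" by (auto simp: common_neighbours_def)
    then have "(\<Sum>x\<in>A. of_bool (x \<in> ?D K)) = card (?D K)" using assms(1) by simp
    then show ?thesis unfolding sum.distrib sum_distrib_left[symmetric] by simp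
  qed
  finally show ?thesis .
qed

text \<open>Writing \<open>d(B)\<close> for the number of common neighbours, the numbers \<open>d(B)\<close> over the \<open>k\<close>-cliques sum to
  \<open>k + 1\<close> times the number of \<open>(k+1)\<close>-cliques, while their squares sum to the total of \<open>d(K - {v})\<close> over
  all \<open>(k+1)\<close>-cliques \<open>K\<close> and \<open>v \<in> K\<close>, which the preceding count bounds. Cauchy--Schwarz compares the
  two.\<close>

lemma moon_moser:
  assumes "finite A"
  shows "(real (Suc k) * card (cliques A G (Suc k)))\<^sup>2
     \<le> card (cliques A G k) *
        (real k * (real (Suc (Suc k)) * card (cliques A G (Suc (Suc k))))
          + real (card A) * card (cliques A G (Suc k)))"
proof -
  let ?C = "cliques A G" and ?d = "\<lambda>K. real (card (common_neighbours A G K))"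
  have "(real (Suc k) * card (?C (Suc k)))\<^sup>2 = (\<Sum>B\<in>?C k. 1 * ?d B)\<^sup>2"
    by (simp only: card_cliques_Suc[OF assms] mult_1)
  also have "\<dots> \<le> (\<Sum>B\<in>?C k. 1\<^sup>2) * (\<Sum>B\<in>?C k. (?d B)\<^sup>2)"
    by (rule Cauchy_Schwarz_ineq_sum)
  also have "(\<Sum>B\<in>?C k. (?d B)\<^sup>2) = (\<Sum>K\<in>?C (Suc k). \<Sum>v\<in>K. ?d (K - {v}))"
    using sum_cliques_remove[OF assms, of ?d G k] by (simp add: power2_eq_square)
  also have "\<dots> \<le> (\<Sum>K\<in>?C (Suc k). real k * ?d K + card A)"
  proof (rule sum_mono)
    fix K assume "K \<in> ?C (Suc k)"
    from sum_common_neighbours_remove_le[OF assms this]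
    have "real (\<Sum>v\<in>K. card (common_neighbours A G (K - {v})))
        \<le> real (k * card (common_neighbours A G K) + card A)" by (rule of_nat_mono)
    then show "(\<Sum>v\<in>K. ?d (K - {v})) \<le> real k * ?d K + card A" by simp
  qed
  also have "\<dots> = real k * (real (Suc (Suc k)) * card (?C (Suc (Suc k))))
          + real (card A) * card (?C (Suc k))"
    by (simp only: card_cliques_Suc[OF assms] sum.distrib sum_distrib_left[symmetric])
       (simp add: mult.commute)
  finally show ?thesis by (simp add: mult_left_mono)
qed

text \<open>With \<open>\<rho>\<^sub>k\<close> for the ratio \<open>(k+1) N\<^bsub>k+1\<^esub> / (n N\<^sub>k)\<close> of consecutive clique numbers, the Moon--Moser
  inequality reads \<open>k \<rho>\<^bsub>k+1\<^esub> \<ge> (k+1) \<rho>\<^sub>k - 1\<close>. Starting from \<open>\<rho>\<^sub>1 \<ge> 1 - \<delta>\<close> this gives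
  \<open>\<rho>\<^sub>k \<ge> 1 - k \<delta>\<close> by induction.\<close>

lemma card_cliques_ratio:
  assumes "finite A"
    and edges: "2 * real (card (cliques A G 2)) \<ge> (1 - \<delta>) * (real (card A))\<^sup>2"
  shows "real (Suc (Suc k)) * card (cliques A G (Suc (Suc k)))
       \<ge> (1 - real (Suc k) * \<delta>) * card A * card (cliques A G (Suc k))"
proof (induction k)
  case 0
  have "cliques A G (Suc 0) = (\<lambda>v. {v}) ` A"
    by (auto simp: cliques_def card_1_singleton_iff)
  then have "card (cliques A G (Suc 0)) = card A" by (simp add: card_image)
  then show ?case using edges by (simp add: numeral_2_eq_2 power2_eq_square algebra_simps)
next
  case (Suc k)
  define N0 where "N0 = real (card (cliques A G (Suc k)))"
  define N1 where "N1 = real (card (cliques A G (Suc (Suc k))))"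
  define N2 where "N2 = real (card (cliques A G (Suc (Suc (Suc k)))))"
  define n where "n = real (card A)"
  have nn: "N0 \<ge> 0" "N1 \<ge> 0" "N2 \<ge> 0" "n \<ge> 0" by (auto simp: N0_def N1_def N2_def n_def)
  have IH: "real (k + 2) * N1 \<ge> (1 - real (k + 1) * \<delta>) * n * N0"
    using Suc by (simp add: N0_def N1_def n_def)
  have mm: "(real (k + 2) * N1)\<^sup>2 \<le> N0 * (real (k + 1) * (real (k + 3) * N2) + n * N1)"
    using moon_moser[OF assms(1), of "Suc k" G]
    by (simp add: N0_def N1_def N2_def n_def add_ac numeral_3_eq_3)
  have "real (k + 3) * N2 \<ge> (1 - real (k + 2) * \<delta>) * n * N1"
  proof (cases "N0 = 0 \<or> N1 = 0")
    case True
    then have "N1 = 0"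
    proof
      assume "N0 = 0"
      then have "(real (k + 2) * N1)\<^sup>2 \<le> 0" using mm by simp
      then show ?thesis by simp
    qed
    then show ?thesis using nn by simp
  next
    case False
    then have pos: "N0 > 0" "N1 > 0" using nn by auto
    have "(real (k + 2) * N1) * ((1 - real (k + 1) * \<delta>) * n * N0) \<le> (real (k + 2) * N1)\<^sup>2"
      unfolding power2_eq_square using IH nn by (intro mult_left_mono) auto
    also note mm
    finally have "N0 * (real (k + 2) * N1 * (1 - real (k + 1) * \<delta>) * n)
        \<le> N0 * (real (k + 1) * (real (k + 3) * N2) + n * N1)"
      by (simp only: mult_ac)
    then have "real (k + 2) * N1 * (1 - real (k + 1) * \<delta>) * n
        \<le> real (k + 1) * (real (k + 3) * N2) + n * N1"
      using pos by simp
    then have "real (k + 1) * ((1 - real (k + 2) * \<delta>) * n * N1) \<le> real (k + 1) * (real (k + 3) * N2)"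
      by (simp add: algebra_simps)
    then show ?thesis by (simp only: mult_le_cancel_left_pos[of "real (k+1)"] of_nat_0_less_iff)
  qed
  then show ?case by (simp add: N1_def N2_def n_def add_ac numeral_3_eq_3)
qed

lemma card_cliques_ge:
  fixes r :: nat and \<delta> :: real
  assumes "finite A" "r * \<delta> < 1" "\<delta> \<ge> 0"
    and edges: "2 * real (card (cliques A G 2)) \<ge> (1 - \<delta>) * (real (card A))\<^sup>2"
    and "k \<le> r"
  shows "real (card (cliques A G (Suc k))) \<ge> ((1 - r * \<delta>) / (r + 1)) ^ k * real (card A) ^ Suc k"
  using \<open>k \<le> r\<close>
proof (induction k)
  case 0
  have "cliques A G (Suc 0) = (\<lambda>v. {v}) ` A"
    by (auto simp: cliques_def card_1_singleton_iff)
  then show ?case by (simp add: card_image)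
next
  case (Suc k)
  define c where "c = (1 - r * \<delta>) / (r + 1)"
  define n where "n = real (card A)"
  define N where "N = real (card (cliques A G (Suc k)))"
  have n0: "n \<ge> 0" "N \<ge> 0" by (auto simp: n_def N_def)
  have c0: "c \<ge> 0" using assms(2) by (simp add: c_def)
  have "real (Suc (Suc k)) * c \<le> real (r + 1) * c"
    using Suc.prems c0 by (intro mult_right_mono) auto
  also have "\<dots> = 1 - r * \<delta>" by (simp add: c_def)
  also have "\<dots> \<le> 1 - real (Suc k) * \<delta>" using Suc.prems assms(3)
    by (intro diff_left_mono mult_right_mono) auto
  finally have "real (Suc (Suc k)) * c * (n * N) \<le> (1 - real (Suc k) * \<delta>) * (n * N)"
    using n0 by (intro mult_right_mono) auto
  also have "\<dots> \<le> real (Suc (Suc k)) * card (cliques A G (Suc (Suc k)))"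
    using card_cliques_ratio[OF assms(1) edges, of k] by (simp add: n_def N_def mult_ac)
  finally have "real (Suc (Suc k)) * (c * n * N) \<le> real (Suc (Suc k)) * card (cliques A G (Suc (Suc k)))"
    by (simp only: mult_ac)
  then have step: "c * n * N \<le> card (cliques A G (Suc (Suc k)))"
    by (simp only: mult_le_cancel_left_pos of_nat_0_less_iff zero_less_Suc)
  have "c ^ k * n ^ Suc k \<le> N" using Suc by (simp add: c_def n_def N_def)
  then have "c * n * (c ^ k * n ^ Suc k) \<le> c * n * N" using c0 n0 by (intro mult_left_mono) auto
  with step have "c ^ Suc k * n ^ Suc (Suc k) \<le> card (cliques A G (Suc (Suc k)))"
    by (simp add: mult_ac)
  then show ?case unfolding c_def n_def .
qed

section \<open>The Erdos--Stone theorem\<close>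

text \<open>Double counting shows that at least \<open>(c/2) \<bar>Y\<bar>\<close> points of \<open>Y\<close> lie in \<open>s\<close> or more of the sets \<open>A x\<close>.
  Each of them chooses \<open>s\<close> such sets, and since there are at most \<open>2 ^ \<bar>T\<bar>\<close> possible choices, one
  choice is made by a \<open>2 ^ \<bar>T\<bar>\<close>-th of these points.\<close>

lemma many_large_subsets_intersect:
  fixes c :: real
  assumes fin: "finite T" "finite Y" and Y: "card Y > 0" and s: "s \<ge> 1" and T: "2 * real s \<le> c * card T"
    and A: "\<And>x. x \<in> T \<Longrightarrow> A x \<subseteq> Y" "\<And>x. x \<in> T \<Longrightarrow> c * card Y \<le> card (A x)"
  obtains S where "S \<subseteq> T" "card S = s"
    "c / (2 * 2 ^ card T) * card Y \<le> card {y\<in>Y. \<forall>x\<in>S. y \<in> A x}"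
proof -
  define N where "N y = {x\<in>T. y \<in> A x}" for y
  define Y' where "Y' = {y\<in>Y. s \<le> card (N y)}"
  have M0: "card T > 0"
    using s T by (cases "card T = 0") auto
  have finY': "finite Y'" using fin by (simp add: Y'_def)
  have "c * card T * card Y = (\<Sum>x\<in>T. c * card Y)" by simp
  also have "\<dots> \<le> (\<Sum>x\<in>T. real (card (A x)))" by (rule sum_mono) (rule A)
  also have "\<dots> = (\<Sum>x\<in>T. \<Sum>y\<in>Y. of_bool (y \<in> A x))"
    using A(1) fin by (intro sum.cong) (auto intro!: arg_cong[where f=card])
  also have "\<dots> = (\<Sum>y\<in>Y. \<Sum>x\<in>T. of_bool (y \<in> A x))" by (rule sum.swap)
  also have "\<dots> = (\<Sum>y\<in>Y. real (card (N y)))"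
    using fin by (intro sum.cong) (auto simp: N_def intro!: arg_cong[where f=card])
  also have "\<dots> \<le> (\<Sum>y\<in>Y. real (card T) * of_bool (y \<in> Y') + real s)"
  proof (rule sum_mono)
    fix y assume "y \<in> Y"
    moreover have "card (N y) \<le> card T" using fin by (auto simp: N_def intro: card_mono)
    ultimately show "real (card (N y)) \<le> real (card T) * of_bool (y \<in> Y') + real s"
      by (auto simp: Y'_def)
  qed
  also have "\<dots> = real (card T) * card Y' + real s * card Y"
    using fin by (simp add: sum.distrib sum_distrib_left[symmetric] Y'_def Int_def)
  finally have 1: "c * card T * card Y \<le> real (card T) * card Y' + real s * card Y" .
  have "2 * real s * card Y \<le> c * card T * card Y" using T by (intro mult_right_mono) auto
  with 1 have "real (card T) * (c / 2 * card Y) \<le> real (card T) * card Y'" by (simp add: algebra_simps)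
  then have Y': "c / 2 * card Y \<le> card Y'" using M0 by simp
  have "\<forall>y\<in>Y'. \<exists>S. S \<subseteq> N y \<and> card S = s"
  proof
    fix y assume "y \<in> Y'"
    then have "s \<le> card (N y)" by (simp add: Y'_def)
    then obtain S where "S \<subseteq> N y" "card S = s" by (rule obtain_subset_with_card_n)
    then show "\<exists>S. S \<subseteq> N y \<and> card S = s" by blast
  qed
  from bchoice[OF this] obtain g where "\<forall>y\<in>Y'. g y \<subseteq> N y \<and> card (g y) = s" ..
  then have g: "g y \<subseteq> N y" "card (g y) = s" if "y \<in> Y'" for y using that by auto
  have "\<exists>S\<in>Pow T. card Y' \<le> 2 ^ card T * card {y\<in>Y'. g y = S}"
  proof (rule ccontr)
    assume "\<not> ?thesis"
    then have less: "\<And>S. S \<in> Pow T \<Longrightarrow> 2 ^ card T * card {y\<in>Y'. g y = S} < card Y'" by (meson not_le)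
    have "(\<Union>S\<in>Pow T. {y\<in>Y'. g y = S}) = Y'" using g(1) by (auto simp: N_def)
    moreover have "card (\<Union>S\<in>Pow T. {y\<in>Y'. g y = S}) \<le> (\<Sum>S\<in>Pow T. card {y\<in>Y'. g y = S})"
      using fin by (intro card_UN_le) simp
    ultimately have "card Y' \<le> (\<Sum>S\<in>Pow T. card {y\<in>Y'. g y = S})" by (simp only:)
    then have "2 ^ card T * card Y' \<le> (\<Sum>S\<in>Pow T. 2 ^ card T * card {y\<in>Y'. g y = S})"
      by (simp add: sum_distrib_left[symmetric])
    also have "\<dots> < (\<Sum>S\<in>Pow T. card Y')" using fin less by (intro sum_strict_mono) auto
    finally show False using fin by (simp add: card_Pow)
  qed
  then obtain S where S: "S \<subseteq> T" "card Y' \<le> 2 ^ card T * card {y\<in>Y'. g y = S}" by auto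
  have "0 < c * card T" using T s by linarith
  then have "c > 0" by (simp add: zero_less_mult_iff)
  then have "0 < c / 2 * card Y" using Y by simp
  then have "card Y' > 0" using Y' by linarith
  with S(2) have "card {y\<in>Y'. g y = S} \<noteq> 0" by (intro notI) simp
  then have "{y\<in>Y'. g y = S} \<noteq> {}" by (intro notI) simp
  then obtain y where "y \<in> Y'" "g y = S" by blast
  then have cS: "card S = s" using g(2) by blast
  have "c / 2 * card Y \<le> real (2 ^ card T * card {y\<in>Y'. g y = S})"
    by (rule order_trans[OF Y']) (use S(2) in \<open>simp only: of_nat_le_iff\<close>)
  also have "card {y\<in>Y'. g y = S} \<le> card {y\<in>Y. \<forall>x\<in>S. y \<in> A x}"
    using fin g by (intro card_mono) (auto simp: Y'_def N_def)
  finally have "c / 2 * card Y \<le> 2 ^ card T * real (card {y\<in>Y. \<forall>x\<in>S. y \<in> A x})" by simp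
  then have "c / (2 * 2 ^ card T) * card Y \<le> card {y\<in>Y. \<forall>x\<in>S. y \<in> A x}"
    by (simp add: field_simps)
  with S(1) cS show ?thesis by (rule that)
qed

text \<open>The box theorem of Erdos for \<open>k\<close>-partite \<open>k\<close>-uniform hypergraphs. In the induction step many heads \<open>x\<close>
  have a positive proportion of all tails; a bounded number \<open>M\<close> of these heads already contains \<open>s\<close>
  heads with a positive proportion of common tails, to which the induction hypothesis applies.\<close>

lemma large_set_of_lists_contains_box:
  fixes c :: real
  assumes "c > 0" "s \<ge> 1"
  shows "\<exists>N. \<forall>(A :: 'v set) W. N \<le> card A \<longrightarrow> finite A \<longrightarrow> W \<subseteq> {xs. set xs \<subseteq> A \<and> length xs = k} \<longrightarrow>
           c * real (card A) ^ k \<le> card W \<longrightarrow>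
           (\<exists>Ss. length Ss = k \<and> (\<forall>S\<in>set Ss. card S = s) \<and> (\<forall>xs. list_all2 (\<in>) xs Ss \<longrightarrow> xs \<in> W))"
  using \<open>c > 0\<close>
proof (induction k arbitrary: c)
  case 0
  have "(\<exists>Ss. length Ss = 0 \<and> (\<forall>S\<in>set Ss. card S = s) \<and> (\<forall>xs. list_all2 (\<in>) xs Ss \<longrightarrow> xs \<in> W))"
    if "W \<subseteq> {xs. set xs \<subseteq> A \<and> length xs = 0}" "c * real (card A) ^ 0 \<le> card W"
    for A :: "'v set" and W
  proof -
    have "W \<noteq> {}" using that(2) 0 by auto
    with that(1) have "[] \<in> W" by auto
    then show ?thesis by (intro exI[of _ "[]"]) auto
  qed
  then show ?case by blast
next
  case (Suc k)
  \<comment> \<open>With \<open>M\<close> heads of tail density \<open>c/2\<close>, a tail belongs on average to at least \<open>2 s\<close> of them.\<close>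
  define M where "M = nat \<lceil>4 * s / c\<rceil>"
  have M: "2 * real s \<le> c / 2 * M"
  proof -
    have "4 * s / c \<le> M" unfolding M_def by linarith
    then show ?thesis using Suc.prems by (simp add: field_simps)
  qed
  define c' where "c' = (c / 2) / (2 * 2 ^ M)"
  have "c' > 0" using Suc.prems by (simp add: c'_def)
  from Suc.IH[OF this] obtain N where N:
    "\<And>(A :: 'v set) W. N \<le> card A \<Longrightarrow> finite A \<Longrightarrow> W \<subseteq> {xs. set xs \<subseteq> A \<and> length xs = k} \<Longrightarrow>
       c' * real (card A) ^ k \<le> card W \<Longrightarrow>
       (\<exists>Ss. length Ss = k \<and> (\<forall>S\<in>set Ss. card S = s) \<and> (\<forall>xs. list_all2 (\<in>) xs Ss \<longrightarrow> xs \<in> W))"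
    by blast
  show ?case
  proof (intro exI[of _ "max (max N 1) (nat \<lceil>2 * M / c\<rceil>)"] allI impI)
    fix A :: "'v set" and W
    assume big: "max (max N 1) (nat \<lceil>2 * M / c\<rceil>) \<le> card A" and fin: "finite A"
      and W: "W \<subseteq> {xs. set xs \<subseteq> A \<and> length xs = Suc k}" "c * real (card A) ^ Suc k \<le> card W"
    define n where "n = real (card A)"
    define Y where "Y = {ys. set ys \<subseteq> A \<and> length ys = k}"
    define B where "B x = {ys. x # ys \<in> W}" for x
    have finY: "finite Y" and cY: "real (card Y) = n ^ k"
      using fin by (simp_all add: Y_def n_def finite_lists_length_eq card_lists_length_eq)
    have n1: "n \<ge> 1" "N \<le> card A" using big by (simp_all add: n_def)
    have BY: "B x \<subseteq> Y" for x using W(1) by (force simp: B_def Y_def)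
    then have finB: "finite (B x)" for x using finY finite_subset by blast
    have cBle: "real (card (B x)) \<le> n ^ k" for x
      using card_mono[OF finY BY[of x]] cY by (metis of_nat_le_iff)
    have W_eq: "W = (\<lambda>(x, ys). x # ys) ` Sigma A B"
    proof (intro equalityI subsetI)
      fix xs assume "xs \<in> W"
      then show "xs \<in> (\<lambda>(x, ys). x # ys) ` Sigma A B"
        using W(1) by (cases xs) (auto simp: B_def image_iff)
    qed (auto simp: B_def)
    have "card W = card (Sigma A B)"
      unfolding W_eq by (rule card_image) (auto simp: inj_on_def)
    also have "\<dots> = (\<Sum>x\<in>A. card (B x))" using fin finB by (simp add: card_SigmaI)
    finally have cW: "card W = (\<Sum>x\<in>A. card (B x))" .
    define X where "X = {x\<in>A. c / 2 * n ^ k \<le> card (B x)}"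
    have finX: "finite X" using fin by (simp add: X_def)
    have "c * n ^ Suc k \<le> (\<Sum>x\<in>A. real (card (B x)))"
      using W(2) cW by (simp add: n_def)
    also have "\<dots> \<le> (\<Sum>x\<in>A. n ^ k * of_bool (x \<in> X) + c / 2 * n ^ k)"
    proof (rule sum_mono)
      fix x assume "x \<in> A"
      then show "real (card (B x)) \<le> n ^ k * of_bool (x \<in> X) + c / 2 * n ^ k"
        using cBle[of x] Suc.prems n1 by (auto simp: X_def intro: add_increasing2)
    qed
    also have "\<dots> = n ^ k * card X + n * (c / 2 * n ^ k)"
    proof -
      have "A \<inter> {x. x \<in> X} = X" by (auto simp: X_def)
      then show ?thesis using fin by (simp add: sum.distrib sum_distrib_left[symmetric] n_def)
    qed
    finally have "n ^ k * (c / 2 * n) \<le> n ^ k * card X" by (simp add: algebra_simps)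
    then have cX: "c / 2 * n \<le> card X" using n1 by simp
    have "2 * M / c \<le> n" using big by (simp add: n_def)
    then have "M \<le> c / 2 * n" using Suc.prems by (simp add: field_simps)
    with cX have "M \<le> card X" by linarith
    then obtain T where T: "T \<subseteq> X" "card T = M" "finite T" by (rule obtain_subset_with_card_n)
    obtain S where S: "S \<subseteq> T" "card S = s"
      "c' * card Y \<le> card {ys\<in>Y. \<forall>x\<in>S. ys \<in> B x}"
    proof (rule many_large_subsets_intersect[of T Y s "c / 2" B])
      show "card Y > 0" using cY n1 by (metis of_nat_0_less_iff zero_less_one less_le_trans zero_less_power)
      show "c / 2 * card Y \<le> card (B x)" if "x \<in> T" for x
        using that T(1) unfolding cY X_def by auto
    qed (use T M finY BY \<open>s \<ge> 1\<close> in \<open>auto simp: c'_def\<close>)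
    define W' where "W' = {ys\<in>Y. \<forall>x\<in>S. ys \<in> B x}"
    have "\<exists>Ss. length Ss = k \<and> (\<forall>S\<in>set Ss. card S = s) \<and> (\<forall>xs. list_all2 (\<in>) xs Ss \<longrightarrow> xs \<in> W')"
    proof (rule N)
      show "W' \<subseteq> {xs. set xs \<subseteq> A \<and> length xs = k}" by (auto simp: W'_def Y_def)
      show "c' * real (card A) ^ k \<le> card W'" using S(3) by (simp add: cY W'_def n_def)
    qed (use n1 fin in auto)
    then obtain Ss where Ss: "length Ss = k" "\<forall>S\<in>set Ss. card S = s" "\<forall>xs. list_all2 (\<in>) xs Ss \<longrightarrow> xs \<in> W'"
      by blast
    show "\<exists>Ss. length Ss = Suc k \<and> (\<forall>S\<in>set Ss. card S = s) \<and> (\<forall>xs. list_all2 (\<in>) xs Ss \<longrightarrow> xs \<in> W)"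
      using Ss S(2) by (intro exI[of _ "S # Ss"]) (auto simp: list_all2_Cons2 W'_def B_def)
  qed
qed

text \<open>A graph this dense has a positive proportion of all \<open>(r+1)\<close>-sets as cliques. Among the lists that
  enumerate these cliques there is a box of \<open>r + 1\<close> sets of size \<open>s\<close>. Any two vertices from different
  sets of the box lie on a common clique list, so they are distinct and adjacent.\<close>

lemma erdos_stone:
  fixes r s :: nat and \<eta> :: real
  assumes "r \<ge> 1" "s \<ge> 1" "\<eta> > 0"
  shows "\<exists>N. \<forall>(A :: 'v set) G. N \<le> card A \<longrightarrow> finite A \<longrightarrow> G \<subseteq> {e. e \<subseteq> A \<and> card e = 2} \<longrightarrow>
     (1 - 1 / r + \<eta>) * (card A choose 2) \<le> card G \<longrightarrow>
     (\<exists>P. (\<forall>i\<le>r. card (P i) = s) \<and>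
          (\<forall>i\<le>r. \<forall>j\<le>r. i \<noteq> j \<longrightarrow> (\<forall>u\<in>P i. \<forall>v\<in>P j. u \<in> A \<and> v \<in> A \<and> u \<noteq> v \<and> {u, v} \<in> G)))"
proof -
  \<comment> \<open>Capping the excess at \<open>1 / r\<close> keeps \<open>\<delta>\<close> non-negative; half of it absorbs the difference between
    \<open>n (n - 1)\<close> and \<open>n\<^sup>2\<close>.\<close>
  define \<eta>' where "\<eta>' = min \<eta> (1 / r)"
  define \<delta> where "\<delta> = 1 / r - \<eta>' / 2"
  have \<eta>': "\<eta>' > 0" "\<eta>' \<le> \<eta>" "\<eta>' \<le> 1 / r" using assms by (auto simp: \<eta>'_def)
  have "\<delta> \<ge> 0" using \<eta>' by (simp add: \<delta>_def)
  have r\<delta>: "real r * \<delta> < 1" using \<eta>' assms(1) by (simp add: \<delta>_def right_diff_distrib)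
  define c where "c = ((1 - r * \<delta>) / (r + 1)) ^ r"
  have "c > 0" using r\<delta> by (simp add: c_def)
  from large_set_of_lists_contains_box[OF this assms(2), of "Suc r", where ?'v = 'v] obtain N where N:
    "\<And>(A :: 'v set) W. N \<le> card A \<Longrightarrow> finite A \<Longrightarrow> W \<subseteq> {xs. set xs \<subseteq> A \<and> length xs = Suc r} \<Longrightarrow>
       c * real (card A) ^ Suc r \<le> card W \<Longrightarrow>
       (\<exists>Ss. length Ss = Suc r \<and> (\<forall>S\<in>set Ss. card S = s) \<and> (\<forall>xs. list_all2 (\<in>) xs Ss \<longrightarrow> xs \<in> W))"
    by blast
  show ?thesis
  proof (intro exI[of _ "max (max N 1) (nat \<lceil>2 / \<eta>'\<rceil>)"] allI impI)
    fix A :: "'v set" and G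
    assume big: "max (max N 1) (nat \<lceil>2 / \<eta>'\<rceil>) \<le> card A" and fin: "finite A"
      and G: "G \<subseteq> {e. e \<subseteq> A \<and> card e = 2}" and dense: "(1 - 1 / r + \<eta>) * (card A choose 2) \<le> card G"
    define n where "n = real (card A)"
    have "N \<le> card A" and n1: "n \<ge> 1" using big by (auto simp: n_def)
    have "2 / \<eta>' \<le> n" using big by (simp add: n_def)
    then have n2: "2 \<le> \<eta>' * n" using \<eta>' by (simp add: field_simps)
    have choose: "2 * real (card A choose 2) = n * (n - 1)"
    proof -
      have "2 * (card A choose 2) = card A * (card A - 1)"
        unfolding choose_two by (rule dvd_mult_div_cancel) (cases "even (card A)"; simp)
      then have "real (2 * (card A choose 2)) = real (card A * (card A - 1))" by (simp only:)
      then show ?thesis using n1 by (simp add: n_def of_nat_diff)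
    qed
    have "G \<subseteq> cliques A G 2"
      using G by (auto simp: cliques_def card_2_iff doubleton_eq_iff insert_commute)
    then have "card G \<le> card (cliques A G 2)" using fin by (intro card_mono finite_cliques)
    have "(1 - \<delta>) * n\<^sup>2 \<le> (1 - 1 / r + \<eta>') * (n * (n - 1))"
    proof -
      have "n * 2 \<le> n * (\<eta>' * n)" using n2 n1 by (intro mult_left_mono) auto
      moreover have "(1 - 1 / r + \<eta>') * n \<le> 1 * n" using \<eta>' n1 by (intro mult_right_mono) auto
      ultimately show ?thesis by (simp add: \<delta>_def power2_eq_square algebra_simps)
    qed
    also have "\<dots> \<le> (1 - 1 / r + \<eta>) * (n * (n - 1))"
      using \<eta>' n1 by (intro mult_right_mono) auto
    also have "\<dots> \<le> 2 * card G" using dense unfolding choose[symmetric] by simp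
    also have "\<dots> \<le> 2 * card (cliques A G 2)" using \<open>card G \<le> _\<close> by simp
    finally have many_edges: "(1 - \<delta>) * (real (card A))\<^sup>2 \<le> 2 * real (card (cliques A G 2))"
      by (simp add: n_def)
    define W where "W = {xs. distinct xs \<and> set xs \<in> cliques A G (Suc r)}"
    have WL: "W \<subseteq> {xs. set xs \<subseteq> A \<and> length xs = Suc r}"
      by (auto simp: W_def cliques_def distinct_card)
    have finW: "finite W" by (rule finite_subset[OF WL]) (use fin in \<open>simp add: finite_lists_length_eq\<close>)
    have "cliques A G (Suc r) \<subseteq> set ` W"
    proof
      fix K assume K: "K \<in> cliques A G (Suc r)"
      from finite_distinct_list[OF finite_clique[OF fin K]] obtain xs where "set xs = K" "distinct xs" by blast
      with K show "K \<in> set ` W" by (auto simp: W_def)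
    qed
    then have "card (cliques A G (Suc r)) \<le> card W"
      using finW by (meson card_image_le card_mono finite_imageI order_trans)
    moreover have "c * real (card A) ^ Suc r \<le> card (cliques A G (Suc r))"
      using card_cliques_ge[OF fin r\<delta> \<open>\<delta> \<ge> 0\<close> many_edges, of r] by (simp add: c_def)
    ultimately have "c * real (card A) ^ Suc r \<le> card W" by linarith
    from N[OF \<open>N \<le> card A\<close> fin WL this] obtain Ss where Ss: "length Ss = Suc r"
      "\<forall>S\<in>set Ss. card S = s" "\<forall>xs. list_all2 (\<in>) xs Ss \<longrightarrow> xs \<in> W"
      by blast
    show "\<exists>P. (\<forall>i\<le>r. card (P i) = s) \<and>
          (\<forall>i\<le>r. \<forall>j\<le>r. i \<noteq> j \<longrightarrow> (\<forall>u\<in>P i. \<forall>v\<in>P j. u \<in> A \<and> v \<in> A \<and> u \<noteq> v \<and> {u, v} \<in> G))"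
    proof (intro exI[of _ "\<lambda>i. Ss ! i"] conjI allI impI ballI)
      fix i assume "i \<le> r"
      then show "card (Ss ! i) = s" using Ss by simp
    next
      fix i j u v assume ij: "i \<le> r" "j \<le> r" "i \<noteq> j" and uv: "u \<in> Ss ! i" "v \<in> Ss ! j"
      \<comment> \<open>A clique list through \<open>u\<close> and \<open>v\<close>, with arbitrary entries in the other classes.\<close>
      define xs where "xs = (map (\<lambda>S. SOME x. x \<in> S) Ss)[i := u, j := v]"
      have "list_all2 (\<in>) xs Ss"
      proof (rule list_all2_all_nthI)
        fix l assume "l < length xs"
        then have "Ss ! l \<in> set Ss" by (simp add: xs_def)
        then have "Ss ! l \<noteq> {}" using Ss(2) assms(2) by fastforce
        then have "(SOME x. x \<in> Ss ! l) \<in> Ss ! l" by (simp add: some_in_eq)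
        then show "xs ! l \<in> Ss ! l" using uv ij Ss(1) \<open>l < length xs\<close>
            by (cases "l = j"; cases "l = i") (simp_all add: xs_def)
      qed (simp add: xs_def)
      then have "distinct xs" "set xs \<in> cliques A G (Suc r)" using Ss(3) by (auto simp: W_def)
      moreover have l: "xs ! i = u" "xs ! j = v" "i < length xs" "j < length xs"
        using ij Ss(1) by (auto simp: xs_def)
      ultimately have "u \<in> set xs" "v \<in> set xs" "u \<noteq> v"
        using ij(3) nth_mem[OF l(3)] nth_mem[OF l(4)] by (auto simp: nth_eq_iff_index_eq)
      then show "u \<in> A" "v \<in> A" "u \<noteq> v" "{u, v} \<in> G"
        using \<open>set xs \<in> cliques A G (Suc r)\<close> by (auto simp: cliques_def)
    qed
  qed
qed

section \<open>Counting q-edges\<close>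

definition pairs :: "nat \<Rightarrow> nat set set" where
  "pairs n = {e. e \<subseteq> {1..n} \<and> card e = 2}"

lemma finite_pairs: "finite (pairs n)"
  unfolding pairs_def by (rule finite_subset[of _ "Pow {1..n}"]) auto

lemma card_pairs: "card (pairs n) = n choose 2"
  using n_subsets[of "{1..n}" 2] by (simp add: pairs_def)

lemma finite_q_edges: "finite (q_edges q n)"
  unfolding q_edges_def by (rule finite_subset[of _ "{1..n} \<rightarrow>\<^sub>E {0..q}"]) (auto intro: finite_PiE)

lemma supp_in_pairs: "x \<in> q_edges q n \<Longrightarrow> supp n x \<in> pairs n"
  by (auto simp: q_edges_def pairs_def supp_def)

text \<open>Restricting a q-edge to its support turns it into an arbitrary function from the support into
  \<open>{l..q}\<close>.\<close>

lemma card_q_edges_with_supp: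
  assumes "e \<in> pairs n" "l \<ge> 1"
  shows "card {x \<in> q_edges q n. supp n x = e \<and> (\<forall>i\<in>e. l \<le> x i)} = (q + 1 - l)\<^sup>2"
proof -
  have e: "e \<subseteq> {1..n}" "card e = 2" "finite e"
    using assms(1) by (auto simp: pairs_def intro: finite_subset)
  let ?ext = "\<lambda>y. \<lambda>i\<in>{1..n}. if i \<in> e then y i else (0::nat)"
  have "bij_betw (\<lambda>x. restrict x e) {x \<in> q_edges q n. supp n x = e \<and> (\<forall>i\<in>e. l \<le> x i)} (e \<rightarrow>\<^sub>E {l..q})"
  proof (rule bij_betw_byWitness[where f' = ?ext])
    show "\<forall>x\<in>{x \<in> q_edges q n. supp n x = e \<and> (\<forall>i\<in>e. l \<le> x i)}. ?ext (restrict x e) = x"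
    proof (intro ballI ext)
      fix x i assume "x \<in> {x \<in> q_edges q n. supp n x = e \<and> (\<forall>i\<in>e. l \<le> x i)}"
      then have x: "x \<in> extensional {1..n}" "supp n x = e" by (simp_all add: q_edges_def PiE_def)
      show "?ext (restrict x e) i = x i"
      proof (cases "i \<in> {1..n}")
        case True
        then show ?thesis using x(2) by (auto simp: supp_def)
      next
        case False
        then show ?thesis using extensional_arb[OF x(1) False] by (simp only: restrict_apply if_False)
      qed
    qed
    show "\<forall>y\<in>e \<rightarrow>\<^sub>E {l..q}. restrict (?ext y) e = y"
    proof (intro ballI ext)
      fix y i assume y: "y \<in> e \<rightarrow>\<^sub>E {l..q}"
      show "restrict (?ext y) e i = y i"
      proof (cases "i \<in> e")
        case True
        then show ?thesis using e(1) by auto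
      next
        case False
        then show ?thesis using PiE_arb[OF y False] by simp
      qed
    qed
    show "(\<lambda>x. restrict x e) ` {x \<in> q_edges q n. supp n x = e \<and> (\<forall>i\<in>e. l \<le> x i)} \<subseteq> e \<rightarrow>\<^sub>E {l..q}"
      using e by (auto simp: q_edges_def PiE_def Pi_def subset_iff)
    show "?ext ` (e \<rightarrow>\<^sub>E {l..q}) \<subseteq> {x \<in> q_edges q n. supp n x = e \<and> (\<forall>i\<in>e. l \<le> x i)}"
    proof (rule image_subsetI)
      fix y assume y: "y \<in> e \<rightarrow>\<^sub>E {l..q}"
      have "y i \<noteq> 0" if "i \<in> e" for i using PiE_mem[OF y that] assms(2) by simp
      then have "supp n (?ext y) = e" using e(1) by (auto simp: supp_def)
      then show "?ext y \<in> {x \<in> q_edges q n. supp n x = e \<and> (\<forall>i\<in>e. l \<le> x i)}"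
        using e y by (auto simp: q_edges_def PiE_def Pi_def subset_iff)
    qed
  qed
  then have "card {x \<in> q_edges q n. supp n x = e \<and> (\<forall>i\<in>e. l \<le> x i)} = card (e \<rightarrow>\<^sub>E {l..q})"
    by (rule bij_betw_same_card)
  also have "\<dots> = (q + 1 - l)\<^sup>2" using e by (simp add: card_PiE Suc_diff_le)
  finally show ?thesis .
qed

lemma card_q_edges_with_supp_all:
  assumes "e \<in> pairs n"
  shows "card {x \<in> q_edges q n. supp n x = e} = q\<^sup>2"
proof -
  have "{x \<in> q_edges q n. supp n x = e} = {x \<in> q_edges q n. supp n x = e \<and> (\<forall>i\<in>e. 1 \<le> x i)}"
    by (auto simp: supp_def)
  then show ?thesis using card_q_edges_with_supp[OF assms, of 1 q] by simp
qed

lemma card_q_graph_eq_sum: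
  assumes "H \<subseteq> q_edges q n"
  shows "card H = (\<Sum>e\<in>pairs n. card {x\<in>H. supp n x = e})"
proof -
  have "(\<Sum>e\<in>pairs n. sum (\<lambda>_. 1::nat) {x. x \<in> H \<and> supp n x = e}) = sum (\<lambda>_. 1) H"
    by (rule sum.group) (use assms finite_subset[OF assms finite_q_edges] in \<open>auto simp: finite_pairs intro: supp_in_pairs\<close>)
  then show ?thesis by simp
qed

lemma card_q_edges: "card (q_edges q n) = q\<^sup>2 * (n choose 2)"
  using card_q_graph_eq_sum[of "q_edges q n" q n]
  by (simp add: card_q_edges_with_supp_all card_pairs mult.commute)

section \<open>Copies as edge assignments\<close>

lemma doubleton_of_edge:
  assumes "simple_graph V E" "e \<in> E"
  obtains u v where "e = {u, v}" "u \<noteq> v" "u \<in> V" "v \<in> V"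
proof -
  have "e \<subseteq> V" "card e = 2" using assms unfolding simple_graph_def by blast+
  from this(2) obtain u v where "e = {u, v}" "u \<noteq> v" unfolding card_2_iff by blast
  with \<open>e \<subseteq> V\<close> show ?thesis by (intro that[of u v]) simp_all
qed

text \<open>This lemma and its converse below replace the isomorphism of the definition by what it amounts to:
  an injection of vertices and, for every edge of F, a q-edge over the image of that edge.\<close>

lemma s_copy_imp_edge_assignment:
  assumes G: "simple_graph V E" and H: "H \<subseteq> q_edges q n" and copy: "s_copy_no_isolated n s (\<Union>E) E H"
  obtains \<iota> X where "inj_on \<iota> (\<Union>E)" "\<And>e. e \<in> E \<Longrightarrow> X e \<in> H \<and> supp n (X e) = \<iota> ` e"
    "\<And>e e' v. e \<in> E \<Longrightarrow> e' \<in> E \<Longrightarrow> e \<noteq> e' \<Longrightarrow> v \<in> e \<Longrightarrow> v \<in> e' \<Longrightarrow> s \<le> X e (\<iota> v) + X e' (\<iota> v)"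
proof -
  from copy obtain \<iota> where card: "card H = card E"
    and iso: "graph_iso (\<Union>E) E (\<Union>x\<in>H. supp n x) (supp n ` H) \<iota>"
    and sum: "\<forall>e\<in>E. \<forall>e'\<in>E. \<forall>v\<in>e \<inter> e'. e \<noteq> e' \<longrightarrow>
          edge_with_supp n H (\<iota> ` e) (\<iota> v) + edge_with_supp n H (\<iota> ` e') (\<iota> v) \<ge> s"
    unfolding s_copy_no_isolated_def by blast
  have inj: "inj_on \<iota> (\<Union>E)" and im: "\<iota> ` \<Union>E = (\<Union>x\<in>H. supp n x)"
    using iso by (simp_all only: graph_iso_def bij_betw_def)
  have adj: "{u, v} \<in> E \<longleftrightarrow> {\<iota> u, \<iota> v} \<in> supp n ` H" if "u \<in> \<Union>E" "v \<in> \<Union>E" for u v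
    using iso that unfolding graph_iso_def by (simp only:)
  have "(`) \<iota> ` E = supp n ` H"
  proof (intro equalityI subsetI)
    fix d assume "d \<in> (`) \<iota> ` E"
    then obtain e where e: "e \<in> E" "d = \<iota> ` e" by auto
    obtain u v where uv: "e = {u, v}" by (rule doubleton_of_edge[OF G e(1)])
    have "{u, v} \<in> E" "u \<in> \<Union>E" "v \<in> \<Union>E" using e(1) uv by auto
    then have "{\<iota> u, \<iota> v} \<in> supp n ` H" by (simp only: adj)
    then show "d \<in> supp n ` H" using e(2) uv by simp
  next
    fix d assume d: "d \<in> supp n ` H"
    then have "d \<in> pairs n" using H supp_in_pairs[of _ q n] by blast
    then have "card d = 2" by (simp add: pairs_def)
    then obtain a b where ab: "d = {a, b}" by (auto simp: card_2_iff)
    have "d \<subseteq> \<iota> ` \<Union>E" unfolding im using d by blast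
    then have "a \<in> \<iota> ` \<Union>E" "b \<in> \<iota> ` \<Union>E" by (simp_all only: ab insert_subset)
    then obtain u v where uv: "u \<in> \<Union>E" "v \<in> \<Union>E" "a = \<iota> u" "b = \<iota> v" by blast
    then have "{u, v} \<in> E" using adj[OF uv(1,2)] d unfolding ab by (simp only:)
    then show "d \<in> (`) \<iota> ` E" using ab uv by (intro image_eqI[of _ _ "{u, v}"]) auto
  qed
  moreover have "inj_on ((`) \<iota>) E"
    by (rule inj_on_subset[OF inj_on_image_Pow[OF inj]]) auto
  ultimately have "card (supp n ` H) = card H" using card_image[of "(`) \<iota>" E] card by (simp only:)
  then have injs: "inj_on (supp n) H"
    by (intro eq_card_imp_inj_on finite_subset[OF H finite_q_edges])
  have X: "edge_with_supp n H (\<iota> ` e) \<in> H \<and> supp n (edge_with_supp n H (\<iota> ` e)) = \<iota> ` e" if "e \<in> E" for e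
  proof -
    have "\<iota> ` e \<in> supp n ` H" using \<open>(`) \<iota> ` E = supp n ` H\<close> that by blast
    then obtain x where "x \<in> H" "supp n x = \<iota> ` e" by auto
    then have "(THE x. x \<in> H \<and> supp n x = \<iota> ` e) = x"
      using inj_onD[OF injs] by (intro the_equality conjI) (assumption+, simp)
    then show ?thesis unfolding edge_with_supp_def using \<open>x \<in> H\<close> \<open>supp n x = _\<close> by (simp only:)
  qed
  show ?thesis
  proof (rule that[of \<iota> "\<lambda>e. edge_with_supp n H (\<iota> ` e)"])
    fix e e' v assume "e \<in> E" "e' \<in> E" "e \<noteq> e'" "v \<in> e" "v \<in> e'"
    then show "s \<le> edge_with_supp n H (\<iota> ` e) (\<iota> v) + edge_with_supp n H (\<iota> ` e') (\<iota> v)"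
      using sum by blast
  qed (fact inj, fact X)
qed

lemma edge_assignment_imp_contains_s_copy:
  assumes G: "simple_graph V E" and H: "H \<subseteq> q_edges q n" and n: "card V \<le> n"
    and inj: "inj_on \<iota> (\<Union>E)" and X: "\<And>e. e \<in> E \<Longrightarrow> X e \<in> H \<and> supp n (X e) = \<iota> ` e"
    and sum: "\<And>e e' v. e \<in> E \<Longrightarrow> e' \<in> E \<Longrightarrow> e \<noteq> e' \<Longrightarrow> v \<in> e \<Longrightarrow> v \<in> e' \<Longrightarrow> s \<le> X e (\<iota> v) + X e' (\<iota> v)"
  shows "contains_s_copy q n s V E H"
proof -
  have im_eq: "\<iota> ` e = \<iota> ` e' \<longleftrightarrow> e = e'" if "e \<subseteq> \<Union>E" "e' \<subseteq> \<Union>E" for e e'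
    using inj_on_image_eq_iff[OF inj that] .
  have injX: "inj_on X E"
  proof (rule inj_onI)
    fix e e' assume ee': "e \<in> E" "e' \<in> E" "X e = X e'"
    then have "\<iota> ` e = \<iota> ` e'" using X by metis
    then show "e = e'" using im_eq[of e e'] ee' by blast
  qed
  have suppX: "supp n ` X ` E = (`) \<iota> ` E" using X by (auto simp: image_iff)
  have UX: "(\<Union>x\<in>X ` E. supp n x) = \<iota> ` \<Union>E" using X by auto
  have ews: "edge_with_supp n (X ` E) (\<iota> ` e) = X e" if "e \<in> E" for e
    unfolding edge_with_supp_def
  proof (rule the_equality)
    show "X e \<in> X ` E \<and> supp n (X e) = \<iota> ` e" using X that by auto
  next
    fix x assume "x \<in> X ` E \<and> supp n x = \<iota> ` e"
    then obtain e' where e': "e' \<in> E" "x = X e'" "\<iota> ` e' = \<iota> ` e" using X by auto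
    then show "x = X e" using im_eq[of e' e] that by blast
  qed
  have "graph_iso (\<Union>E) E (\<Union>x\<in>X ` E. supp n x) (supp n ` X ` E) \<iota>"
    unfolding graph_iso_def UX unfolding suppX
  proof (intro conjI ballI)
    show "bij_betw \<iota> (\<Union>E) (\<iota> ` \<Union>E)" using inj by (rule inj_on_imp_bij_betw)
    fix u v assume uv: "u \<in> \<Union>E" "v \<in> \<Union>E"
    show "{u, v} \<in> E \<longleftrightarrow> {\<iota> u, \<iota> v} \<in> (`) \<iota> ` E"
    proof
      assume "{u, v} \<in> E"
      then show "{\<iota> u, \<iota> v} \<in> (`) \<iota> ` E" by (intro image_eqI[of _ _ "{u, v}"]) auto
    next
      assume "{\<iota> u, \<iota> v} \<in> (`) \<iota> ` E"
      then obtain e where e: "e \<in> E" "\<iota> ` {u, v} = \<iota> ` e" by auto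
      then have "{u, v} = e" using im_eq[of "{u, v}" e] uv by blast
      then show "{u, v} \<in> E" using e by simp
    qed
  qed
  moreover have "card (X ` E) = card E" using injX by (rule card_image)
  ultimately have "s_copy_no_isolated n s (\<Union>E) E (X ` E)"
    unfolding s_copy_no_isolated_def using ews sum by (intro conjI exI[of _ \<iota>]) auto
  moreover have "X ` E \<subseteq> H" using X by auto
  ultimately show ?thesis unfolding contains_s_copy_def s_copy_def using n H by blast
qed

section \<open>Chromatic numbers\<close>

lemma ex_proper_coloring:
  assumes "simple_graph V E"
  shows "\<exists>c. proper_coloring V E (chromatic_number V E) c"
proof -
  from assms have "finite V" by (simp add: simple_graph_def)
  then obtain f n where f: "f ` V = {i::nat. i < n}" "inj_on f V"
    using finite_imp_inj_to_nat_seg by blast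
  have "proper_coloring V E n f"
    unfolding proper_coloring_def
  proof (intro conjI allI impI)
    show "f \<in> V \<rightarrow> {..<n}" using f(1) by auto
    fix u v assume "{u, v} \<in> E"
    then have "{u, v} \<subseteq> V" "card {u, v} = 2" using assms unfolding simple_graph_def by blast+
    then have "u \<noteq> v" "u \<in> V" "v \<in> V" by (auto simp: card_insert_if split: if_splits)
    then show "f u \<noteq> f v" using f(2) by (auto dest: inj_onD)
  qed
  then have "\<exists>k c. proper_coloring V E k c" by blast
  then show ?thesis unfolding chromatic_number_def by (rule LeastI_ex)
qed

lemma chromatic_number_le: "proper_coloring V E k c \<Longrightarrow> chromatic_number V E \<le> k"
  unfolding chromatic_number_def by (rule Least_le) (rule exI)

lemma chromatic_number_ge_2:
  assumes "simple_graph V E" "e \<in> E"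
  shows "chromatic_number V E \<ge> 2"
proof -
  from ex_proper_coloring[OF assms(1)] obtain c where c: "proper_coloring V E (chromatic_number V E) c" ..
  obtain u v where "e = {u, v}" "u \<in> V" "v \<in> V" by (rule doubleton_of_edge[OF assms])
  moreover have "c \<in> V \<rightarrow> {..<chromatic_number V E}" "\<And>u v. {u, v} \<in> E \<Longrightarrow> c u \<noteq> c v"
    using c by (simp_all add: proper_coloring_def)
  ultimately have "c u < chromatic_number V E" "c v < chromatic_number V E" "c u \<noteq> c v"
    using assms(2) by blast+
  then show ?thesis by linarith
qed

lemma robust_chromatic_number_le:
  "one_selection E f \<Longrightarrow> robust_chromatic_number V E \<le> chromatic_number V (one_removed E f)"
  unfolding robust_chromatic_number_def by (rule cINF_lower) simp_all

text \<open>An edge inside \<open>C\<close> can only be selected by a vertex of \<open>C\<close>, and there are fewer vertices than edges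
  in \<open>C\<close>. Some edge thus survives every 1-selection.\<close>

lemma robust_chromatic_number_ge_2:
  assumes G: "simple_graph V E" and C: "C \<subseteq> V" "card C < card (induced_edges E C)"
  shows "robust_chromatic_number V E \<ge> 2"
proof -
  have "\<forall>v\<in>\<Union>E. \<exists>e. e \<in> E \<and> v \<in> e" by blast
  from bchoice[OF this] have "{f. one_selection E f} \<noteq> {}"
    unfolding one_selection_def by (simp only: Collect_empty_eq not_all not_not)
  moreover have "2 \<le> chromatic_number V (one_removed E f)" if f: "one_selection E f" for f
  proof -
    have finC: "finite C" using G C(1) by (auto simp: simple_graph_def intro: finite_subset)
    have "\<not> induced_edges E C \<subseteq> f ` (C \<inter> \<Union>E)"
    proof
      assume "induced_edges E C \<subseteq> f ` (C \<inter> \<Union>E)"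
      then have "card (induced_edges E C) \<le> card (f ` (C \<inter> \<Union>E))"
        using finC by (intro card_mono) simp_all
      also have "\<dots> \<le> card (C \<inter> \<Union>E)" using finC by (intro card_image_le) simp
      also have "\<dots> \<le> card C" using finC by (intro card_mono) auto
      finally show False using C(2) by simp
    qed
    then obtain e where "e \<in> induced_edges E C" and e3: "e \<notin> f ` (C \<inter> \<Union>E)" by blast
    then have e: "e \<in> E" "e \<subseteq> C" by (simp_all add: induced_edges_def)
    have "e \<notin> f ` \<Union>E"
    proof
      assume "e \<in> f ` \<Union>E"
      then obtain v where v: "e = f v" "v \<in> \<Union>E" by (rule imageE)
      with f have "v \<in> e" unfolding one_selection_def by (simp only:)
      then have "v \<in> C \<inter> \<Union>E" using v(2) e(2) by blast
      then show False using v(1) e3 by blast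
    qed
    then have "e \<in> one_removed E f" using e(1) by (simp add: one_removed_def)
    moreover have "simple_graph V (one_removed E f)"
      using G by (auto simp: simple_graph_def one_removed_def)
    ultimately show ?thesis by (intro chromatic_number_ge_2)
  qed
  ultimately show ?thesis unfolding robust_chromatic_number_def by (intro cINF_greatest) simp_all
qed

section \<open>The lower bound construction\<close>

definition congruent_pairs :: "nat \<Rightarrow> nat \<Rightarrow> nat set set" where
  "congruent_pairs t n = {e \<in> pairs n. \<forall>i\<in>e. \<forall>j\<in>e. i mod t = j mod t}"

text \<open>The \<open>t\<close>-blocks that start at the elements of the residue class of \<open>n + 1\<close> are disjoint and fit into
  \<open>{1..n}\<close>.\<close>

lemma card_congruent_below:
  assumes "t \<ge> 1"
  shows "t * card {i \<in> {1..n}. i mod t = Suc n mod t} \<le> n"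
proof -
  let ?S = "{i \<in> {1..n}. i mod t = Suc n mod t}"
  have "inj_on (\<lambda>(i, a). i + a) (?S \<times> {..<t})"
  proof (rule inj_onI, clarify)
    fix i a j b :: nat
    assume *: "i mod t = Suc n mod t" "j mod t = Suc n mod t" "a < t" "b < t" "i + a = j + b"
    have "i = j"
    proof (rule ccontr)
      assume "i \<noteq> j"
      have "int i mod int t = int j mod int t" using *(1,2) by (simp flip: zmod_int)
      then have "int t dvd int i - int j" by (simp add: mod_eq_dvd_iff)
      moreover have "int i - int j \<noteq> 0" "\<bar>int i - int j\<bar> < int t" using * \<open>i \<noteq> j\<close> by linarith+
      ultimately show False using dvd_imp_le_int[of "int i - int j" "int t"] by simp
    qed
    with * show "i = j \<and> a = b" by simp
  qed
  moreover have "(\<lambda>(i, a). i + a) ` (?S \<times> {..<t}) \<subseteq> {1..n}"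
  proof clarify
    fix i a assume *: "i \<in> {1..n}" "i mod t = Suc n mod t" "a < t"
    have "t dvd Suc n - i" using *(1) *(2)[symmetric] by (subst mod_eq_dvd_iff_nat[symmetric]) auto
    then have "t \<le> Suc n - i" using * by (intro dvd_imp_le) auto
    then show "i + a \<in> {1..n}" using * by auto
  qed
  ultimately have "card (?S \<times> {..<t}) \<le> card {1..n}" by (intro card_inj_on_le) auto
  then show ?thesis by (simp add: mult.commute)
qed

lemma card_congruent_pairs_le:
  assumes "t \<ge> 1"
  shows "t * card (congruent_pairs t n) \<le> n choose 2"
proof (induction n)
  case 0
  have "congruent_pairs t 0 = {}" by (auto simp: congruent_pairs_def pairs_def)
  then show ?case by simp
next
  case (Suc n)
  let ?S = "{i \<in> {1..n}. i mod t = Suc n mod t}"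
  have "congruent_pairs t (Suc n) \<subseteq> congruent_pairs t n \<union> (\<lambda>i. {i, Suc n}) ` ?S"
  proof
    fix e assume "e \<in> congruent_pairs t (Suc n)"
    then have e: "e \<subseteq> {1..Suc n}" "card e = 2" "\<forall>i\<in>e. \<forall>j\<in>e. i mod t = j mod t"
      unfolding congruent_pairs_def pairs_def by blast+
    show "e \<in> congruent_pairs t n \<union> (\<lambda>i. {i, Suc n}) ` ?S"
    proof (cases "Suc n \<in> e")
      case True
      with e(2) obtain i where i: "e = {i, Suc n}" "i \<noteq> Suc n"
        by (auto simp: card_2_iff insert_commute)
      then have "i mod t = Suc n mod t" "i \<in> {1..n}" using e(3) e(1) by (blast, auto)
      then have "i \<in> ?S" by blast
      then show ?thesis using i by blast
    next
      case False
      then have "e \<subseteq> {1..n}" using e(1) by (auto simp: atLeastAtMostSuc_conv)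
      then show ?thesis using e unfolding congruent_pairs_def pairs_def by blast
    qed
  qed
  then have "card (congruent_pairs t (Suc n)) \<le> card (congruent_pairs t n \<union> (\<lambda>i. {i, Suc n}) ` ?S)"
    by (rule card_mono[rotated]) (auto simp: congruent_pairs_def finite_pairs)
  also have "\<dots> \<le> card (congruent_pairs t n) + card ?S"
    by (rule order_trans[OF card_Un_le]) (auto intro: card_image_le)
  finally have "t * card (congruent_pairs t (Suc n)) \<le> t * card (congruent_pairs t n) + t * card ?S"
    by (simp flip: add_mult_distrib2)
  also have "\<dots> \<le> (n choose 2) + n" using Suc card_congruent_below[OF assms, of n] by (rule add_mono)
  also have "\<dots> = Suc n choose 2" by (simp add: numeral_2_eq_2)
  finally show ?case .
qed

text \<open>A Turan graph with \<open>t\<close> classes in which each pair is replaced by all its q-edges, together with the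
  q-edges inside the classes that have a small entry.\<close>

definition turan_q_graph :: "nat \<Rightarrow> nat \<Rightarrow> nat \<Rightarrow> (nat \<Rightarrow> nat) set" where
  "turan_q_graph q t n = {x \<in> q_edges q n.
     supp n x \<in> congruent_pairs t n \<longrightarrow> (\<exists>i\<in>supp n x. x i \<le> q div 2)}"

lemma card_turan_q_graph:
  assumes "t \<ge> 1"
  shows "real (card (turan_q_graph q t n)) \<ge> (real q ^ 2 - real (q - q div 2) ^ 2 / t) * (n choose 2)"
proof -
  define R where "R = q_edges q n - turan_q_graph q t n"
  have sub: "turan_q_graph q t n \<subseteq> q_edges q n" by (auto simp: turan_q_graph_def)
  have "card R = (\<Sum>e\<in>pairs n. card {x\<in>R. supp n x = e})"
    by (rule card_q_graph_eq_sum) (auto simp: R_def)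
  also have "\<dots> = (\<Sum>e\<in>pairs n. if e \<in> congruent_pairs t n then (q - q div 2)\<^sup>2 else 0)"
  proof (rule sum.cong)
    fix e assume e: "e \<in> pairs n"
    have "{x\<in>R. supp n x = e} = (if e \<in> congruent_pairs t n
        then {x \<in> q_edges q n. supp n x = e \<and> (\<forall>i\<in>e. q div 2 + 1 \<le> x i)} else {})"
      by (auto simp: R_def turan_q_graph_def not_le Suc_le_eq)
    then show "card {x\<in>R. supp n x = e} = (if e \<in> congruent_pairs t n then (q - q div 2)\<^sup>2 else 0)"
      using card_q_edges_with_supp[OF e, of "q div 2 + 1" q] by simp
  qed simp
  also have "\<dots> = card (congruent_pairs t n) * (q - q div 2)\<^sup>2"
  proof -
    have "{e \<in> pairs n. e \<in> congruent_pairs t n} = congruent_pairs t n"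
      by (auto simp: congruent_pairs_def)
    then show ?thesis by (simp add: sum.If_cases[OF finite_pairs] Int_def)
  qed
  finally have R: "card R = card (congruent_pairs t n) * (q - q div 2)\<^sup>2" .
  have "real t * card (congruent_pairs t n) \<le> n choose 2"
    using card_congruent_pairs_le[OF assms, of n] by (metis of_nat_le_iff of_nat_mult)
  then have "real (card (congruent_pairs t n)) \<le> (n choose 2) / t"
    using assms by (simp add: field_simps)
  then have "real (card R) \<le> (n choose 2) / t * real (q - q div 2) ^ 2"
    unfolding R of_nat_mult of_nat_power by (rule mult_right_mono) simp
  moreover have "card (q_edges q n) = card R + card (turan_q_graph q t n)"
    using sub finite_q_edges[of q n] card_mono[OF finite_q_edges sub]
    by (simp add: R_def card_Diff_subset finite_subset[OF sub])
  then have "real q ^ 2 * (n choose 2) = real (card R) + card (turan_q_graph q t n)"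
    by (simp flip: of_nat_add of_nat_mult of_nat_power add: card_q_edges)
  ultimately show ?thesis by (simp add: algebra_simps)
qed

text \<open>In a copy the vertex \<open>v\<close> has at most one edge whose entry at \<open>v\<close> is at most \<open>q div 2\<close>, since two such
  entries sum to at most \<open>q\<close>. Selecting these edges removes every edge inside a residue class.\<close>

lemma turan_q_graph_copy_free:
  assumes G: "simple_graph V E" and t: "t \<ge> 1" "t < robust_chromatic_number V E"
  shows "\<not> contains_s_copy q n (q + 1) V E (turan_q_graph q t n)"
proof
  assume "contains_s_copy q n (q + 1) V E (turan_q_graph q t n)"
  then obtain H where H: "H \<subseteq> turan_q_graph q t n" "H \<subseteq> q_edges q n"
    "s_copy_no_isolated n (q + 1) (\<Union>E) E H"
    by (auto simp: contains_s_copy_def s_copy_def)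
  from s_copy_imp_edge_assignment[OF G H(2,3)] obtain \<iota> X where
    inj: "inj_on \<iota> (\<Union>E)" and X: "\<And>e. e \<in> E \<Longrightarrow> X e \<in> H \<and> supp n (X e) = \<iota> ` e" and
    sum: "\<And>e e' v. e \<in> E \<Longrightarrow> e' \<in> E \<Longrightarrow> e \<noteq> e' \<Longrightarrow> v \<in> e \<Longrightarrow> v \<in> e' \<Longrightarrow> q + 1 \<le> X e (\<iota> v) + X e' (\<iota> v)"
    by blast
  define small where "small v e \<longleftrightarrow> e \<in> E \<and> v \<in> e \<and> X e (\<iota> v) \<le> q div 2" for v e
  have unique: "e = e'" if "small v e" "small v e'" for v e e'
  proof (rule ccontr)
    assume "e \<noteq> e'"
    then have "q + 1 \<le> X e (\<iota> v) + X e' (\<iota> v)" using that by (intro sum) (auto simp: small_def)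
    moreover have "X e (\<iota> v) \<le> q div 2" "X e' (\<iota> v) \<le> q div 2" using that by (auto simp: small_def)
    ultimately show False by linarith
  qed
  \<comment> \<open>Vertices without a small edge still have to select some edge; which one does not matter.\<close>
  define f where "f v = (if \<exists>e. small v e then THE e. small v e else SOME e. e \<in> E \<and> v \<in> e)" for v
  have f_small: "f v = e" if "small v e" for v e
  proof -
    have "(THE e. small v e) = e" by (rule the_equality) (use that unique in blast)+
    then show ?thesis using that unfolding f_def by auto
  qed
  have sel: "one_selection E f"
    unfolding one_selection_def
  proof
    fix v assume "v \<in> \<Union>E"
    then have ex: "\<exists>e. e \<in> E \<and> v \<in> e" by blast
    show "f v \<in> E \<and> v \<in> f v"
    proof (cases "\<exists>e. small v e")
      case True
      then obtain e where "small v e" ..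
      then show ?thesis using f_small[of v e] by (auto simp: small_def)
    next
      case False
      then show ?thesis using someI_ex[OF ex] by (auto simp: f_def)
    qed
  qed
  have "proper_coloring V (one_removed E f) t (\<lambda>v. \<iota> v mod t)"
    unfolding proper_coloring_def
  proof (intro conjI allI impI)
    show "(\<lambda>v. \<iota> v mod t) \<in> V \<rightarrow> {..<t}" using t(1) by auto
    fix u v assume uv: "{u, v} \<in> one_removed E f"
    then have e: "{u, v} \<in> E" "{u, v} \<notin> f ` \<Union>E" by (auto simp: one_removed_def)
    show "\<iota> u mod t \<noteq> \<iota> v mod t"
    proof
      assume eq: "\<iota> u mod t = \<iota> v mod t"
      have X': "X {u, v} \<in> turan_q_graph q t n" "supp n (X {u, v}) = {\<iota> u, \<iota> v}"
        using X[OF e(1)] H(1) by auto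
      then have "{\<iota> u, \<iota> v} \<in> pairs n" using supp_in_pairs by (fastforce simp: turan_q_graph_def)
      then have "{\<iota> u, \<iota> v} \<in> congruent_pairs t n" using eq by (auto simp: congruent_pairs_def)
      then have "X {u, v} (\<iota> u) \<le> q div 2 \<or> X {u, v} (\<iota> v) \<le> q div 2"
        using X' by (auto simp: turan_q_graph_def)
      then have "small u {u, v} \<or> small v {u, v}" using e(1) by (auto simp: small_def)
      then have "f u = {u, v} \<or> f v = {u, v}" using f_small by blast
      moreover have "u \<in> \<Union>E" "v \<in> \<Union>E" using e(1) by auto
      ultimately show False using e(2) by (metis image_eqI)
    qed
  qed
  then have "chromatic_number V (one_removed E f) \<le> t" by (rule chromatic_number_le)
  then show False using robust_chromatic_number_le[OF sel, of V] t(2) by linarith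
qed

section \<open>The upper bound\<close>

text \<open>Any copy of F in this ordinary graph lifts to a \<open>(q+1)\<close>-copy, because two entries above \<open>q div 2\<close> sum
  to at least \<open>q + 1\<close>.\<close>

definition big_pairs :: "nat \<Rightarrow> nat \<Rightarrow> (nat \<Rightarrow> nat) set \<Rightarrow> nat set set" where
  "big_pairs q n H = {e \<in> pairs n. \<exists>x\<in>H. supp n x = e \<and> (\<forall>i\<in>e. q div 2 < x i)}"

text \<open>Every pair outside the graph misses all \<open>(q - q div 2)\<^sup>2\<close> q-edges with both entries above
  \<open>q div 2\<close>. The bound is stated without subtraction on the natural numbers.\<close>

lemma card_q_graph_le:
  assumes H: "H \<subseteq> q_edges q n"
  shows "card H + (q - q div 2)\<^sup>2 * (n choose 2) \<le> q\<^sup>2 * (n choose 2) + (q - q div 2)\<^sup>2 * card (big_pairs q n H)"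
proof -
  let ?w = "(q - q div 2)\<^sup>2" and ?G = "big_pairs q n H"
  have fiber: "card {x\<in>H. supp n x = e} + ?w \<le> q\<^sup>2 + ?w * of_bool (e \<in> ?G)" if e: "e \<in> pairs n" for e
  proof (cases "e \<in> ?G")
    case True
    have "card {x\<in>H. supp n x = e} \<le> card {x \<in> q_edges q n. supp n x = e}"
      using H by (intro card_mono) (auto simp: finite_q_edges)
    then show ?thesis using True card_q_edges_with_supp_all[OF e, of q] by simp
  next
    case False
    let ?B = "{x \<in> q_edges q n. supp n x = e \<and> (\<forall>i\<in>e. q div 2 + 1 \<le> x i)}"
    have "{x\<in>H. supp n x = e} \<inter> ?B = {}" using False e by (auto simp: big_pairs_def Suc_le_eq)
    moreover have "finite {x\<in>H. supp n x = e}" "finite ?B"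
      using finite_subset[OF H finite_q_edges] by (auto simp: finite_q_edges)
    ultimately have "card {x\<in>H. supp n x = e} + card ?B = card ({x\<in>H. supp n x = e} \<union> ?B)"
      by (simp add: card_Un_disjoint)
    also have "\<dots> \<le> card {x \<in> q_edges q n. supp n x = e}"
      using H by (intro card_mono) (auto simp: finite_q_edges)
    finally show ?thesis
      using False card_q_edges_with_supp_all[OF e, of q] card_q_edges_with_supp[OF e, of "q div 2 + 1" q]
      by simp
  qed
  have "card H + ?w * (n choose 2) = (\<Sum>e\<in>pairs n. card {x\<in>H. supp n x = e} + ?w)"
    unfolding sum.distrib card_q_graph_eq_sum[OF H] by (simp add: card_pairs)
  also have "\<dots> \<le> (\<Sum>e\<in>pairs n. q\<^sup>2 + ?w * of_bool (e \<in> ?G))"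
    by (rule sum_mono) (rule fiber)
  also have "\<dots> = q\<^sup>2 * (n choose 2) + ?w * card ?G"
  proof -
    have "pairs n \<inter> {e. e \<in> ?G} = ?G" by (auto simp: big_pairs_def)
    then have "(\<Sum>e\<in>pairs n. of_bool (e \<in> ?G)) = card ?G" by (simp add: finite_pairs)
    then show ?thesis unfolding sum.distrib sum_distrib_left[symmetric] by (simp add: card_pairs)
  qed
  finally show ?thesis .
qed

lemma contains_s_copy_if_big_pairs_contain:
  assumes G: "simple_graph V E" and H: "H \<subseteq> q_edges q n" and n: "card V \<le> n"
    and inj: "inj_on \<iota> (\<Union>E)" and emb: "\<And>e. e \<in> E \<Longrightarrow> \<iota> ` e \<in> big_pairs q n H"
  shows "contains_s_copy q n (q + 1) V E H"
proof -
  have "\<forall>e\<in>E. \<exists>x. x \<in> H \<and> supp n x = \<iota> ` e \<and> (\<forall>i\<in>\<iota> ` e. q div 2 < x i)"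
    using emb unfolding big_pairs_def by blast
  from bchoice[OF this] obtain X where
    X: "\<forall>e\<in>E. X e \<in> H \<and> supp n (X e) = \<iota> ` e \<and> (\<forall>i\<in>\<iota> ` e. q div 2 < X e i)" ..
  show ?thesis
  proof (rule edge_assignment_imp_contains_s_copy[OF G H n inj])
    show "X e \<in> H \<and> supp n (X e) = \<iota> ` e" if "e \<in> E" for e using X that by blast
    show "q + 1 \<le> X e (\<iota> v) + X e' (\<iota> v)" if "e \<in> E" "e' \<in> E" "e \<noteq> e'" "v \<in> e" "v \<in> e'" for e e' v
    proof -
      have "q div 2 < X e (\<iota> v)" "q div 2 < X e' (\<iota> v)" using X that by blast+
      then show ?thesis by linarith
    qed
  qed
qed

text \<open>Each colour class of F is placed into its own part; parts of size \<open>card V\<close> leave room for any class.\<close>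

lemma embeds_into_complete_multipartite:
  assumes G: "simple_graph V E" and c: "proper_coloring V E (Suc r) c" and "V \<noteq> {}"
    and P: "\<And>i. i \<le> r \<Longrightarrow> card (P i) = card V"
    and adj: "\<And>i j u v. i \<le> r \<Longrightarrow> j \<le> r \<Longrightarrow> i \<noteq> j \<Longrightarrow> u \<in> P i \<Longrightarrow> v \<in> P j \<Longrightarrow> u \<noteq> v \<and> {u, v} \<in> G"
  obtains \<iota> where "inj_on \<iota> V" "\<And>e. e \<in> E \<Longrightarrow> \<iota> ` e \<in> G"
proof -
  have finV: "finite V" using G by (simp add: simple_graph_def)
  have cr: "c v \<le> r" if "v \<in> V" for v
  proof -
    have "c \<in> V \<rightarrow> {..<Suc r}" using c by (simp add: proper_coloring_def)
    from funcset_mem[OF this that] show ?thesis by simp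
  qed
  have "\<forall>i\<in>{..r}. \<exists>g. bij_betw g V (P i)"
  proof
    fix i assume "i \<in> {..r}"
    then have ci: "card (P i) = card V" using P by simp
    moreover have "card V > 0" using finV \<open>V \<noteq> {}\<close> by (simp add: card_gt_0_iff)
    ultimately have "finite (P i)" using card_gt_0_iff by metis
    then show "\<exists>g. bij_betw g V (P i)" using finV ci by (intro finite_same_card_bij) auto
  qed
  from bchoice[OF this] obtain g where g: "\<forall>i\<in>{..r}. bij_betw (g i) V (P i)" ..
  define \<iota> where "\<iota> v = g (c v) v" for v
  have mem: "\<iota> v \<in> P (c v)" if "v \<in> V" for v
    using g cr[OF that] bij_betwE[of "g (c v)" V "P (c v)"] that by (auto simp: \<iota>_def)
  have diff: "\<iota> u \<noteq> \<iota> v \<and> {\<iota> u, \<iota> v} \<in> G" if "u \<in> V" "v \<in> V" "c u \<noteq> c v" for u v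
    using adj[OF cr cr that(3) mem mem] that by blast
  show ?thesis
  proof
    show "inj_on \<iota> V"
    proof (rule inj_onI)
      fix u v assume uv: "u \<in> V" "v \<in> V" "\<iota> u = \<iota> v"
      then have same: "c u = c v" using diff by blast
      have "inj_on (g (c u)) V" using g cr[OF uv(1)] by (auto simp: bij_betw_def)
      moreover have "g (c u) u = g (c u) v" using uv(3) same by (simp add: \<iota>_def)
      ultimately show "u = v" using uv(1,2) by (simp add: inj_on_eq_iff)
    qed
    show "\<iota> ` e \<in> G" if e: "e \<in> E" for e
    proof -
      from doubleton_of_edge[OF G e] obtain u v where uv: "e = {u, v}" "u \<in> V" "v \<in> V" by metis
      then have "c u \<noteq> c v" using c e by (auto simp: proper_coloring_def)
      then show ?thesis using diff uv by simp
    qed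
  qed
qed

lemma copy_free_card_le:
  fixes \<eta> :: real
  assumes G: "simple_graph V E" and chi: "chromatic_number V E = Suc r" "r \<ge> 1" and "\<eta> > 0"
  shows "\<exists>N. \<forall>n\<ge>N. \<forall>H. H \<subseteq> q_edges q n \<longrightarrow> \<not> contains_s_copy q n (q + 1) V E H \<longrightarrow>
    real (card H) \<le> (real q ^ 2 - real (q - q div 2) ^ 2 / r + \<eta>) * (n choose 2)"
proof -
  define w where "w = real (q - q div 2) ^ 2"
  \<comment> \<open>An excess of \<open>\<eta>'\<close> in the graph costs \<open>w * \<eta>'\<close> in the q-graph.\<close>
  define \<eta>' where "\<eta>' = \<eta> / (w + 1)"
  have w0: "w \<ge> 0" by (simp add: w_def)
  have \<eta>': "\<eta>' > 0" "w * \<eta>' \<le> \<eta>" using \<open>\<eta> > 0\<close> w0 by (auto simp: \<eta>'_def field_simps)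
  have finV: "finite V" using G by (simp add: simple_graph_def)
  from ex_proper_coloring[OF G] chi obtain c where c: "proper_coloring V E (Suc r) c" by auto
  have "V \<noteq> {}"
  proof
    assume "V = {}"
    then have "proper_coloring V E 0 (\<lambda>_. 0)"
      using G by (auto simp: proper_coloring_def simple_graph_def)
    then show False using chromatic_number_le[of V E 0] chi by auto
  qed
  then have "card V \<ge> 1" using finV by (simp add: Suc_le_eq card_gt_0_iff)
  from erdos_stone[OF chi(2) this \<eta>'(1), where ?'v = nat] obtain N where N:
    "\<forall>(A :: nat set) G. N \<le> card A \<longrightarrow> finite A \<longrightarrow> G \<subseteq> {e. e \<subseteq> A \<and> card e = 2} \<longrightarrow>
     (1 - 1 / r + \<eta>') * (card A choose 2) \<le> card G \<longrightarrow>
     (\<exists>P. (\<forall>i\<le>r. card (P i) = card V) \<and>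
          (\<forall>i\<le>r. \<forall>j\<le>r. i \<noteq> j \<longrightarrow> (\<forall>u\<in>P i. \<forall>v\<in>P j. u \<in> A \<and> v \<in> A \<and> u \<noteq> v \<and> {u, v} \<in> G)))" ..
  show ?thesis
  proof (intro exI[of _ "max N (card V)"] allI impI)
    fix n H assume n: "max N (card V) \<le> n" and H: "H \<subseteq> q_edges q n"
      and free: "\<not> contains_s_copy q n (q + 1) V E H"
    let ?G = "big_pairs q n H"
    have "\<not> (1 - 1 / r + \<eta>') * (n choose 2) \<le> card ?G"
    proof
      assume dense: "(1 - 1 / r + \<eta>') * (n choose 2) \<le> card ?G"
      have "?G \<subseteq> {e. e \<subseteq> {1..n} \<and> card e = 2}" by (auto simp: big_pairs_def pairs_def)
      moreover have "N \<le> card {1..n}" "(1 - 1 / r + \<eta>') * (card {1..n} choose 2) \<le> card ?G"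
        using n dense by simp_all
      ultimately have "\<exists>P. (\<forall>i\<le>r. card (P i) = card V) \<and> (\<forall>i\<le>r. \<forall>j\<le>r. i \<noteq> j \<longrightarrow>
          (\<forall>u\<in>P i. \<forall>v\<in>P j. u \<in> {1..n} \<and> v \<in> {1..n} \<and> u \<noteq> v \<and> {u, v} \<in> ?G))"
        by (intro N[rule_format]) simp_all
      then obtain P where P: "\<forall>i\<le>r. card (P i) = card V"
        "\<forall>i\<le>r. \<forall>j\<le>r. i \<noteq> j \<longrightarrow>
          (\<forall>u\<in>P i. \<forall>v\<in>P j. u \<in> {1..n} \<and> v \<in> {1..n} \<and> u \<noteq> v \<and> {u, v} \<in> ?G)"
        by (elim exE conjE)
      obtain \<iota> where \<iota>: "inj_on \<iota> V" "\<And>e. e \<in> E \<Longrightarrow> \<iota> ` e \<in> ?G"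
        by (rule embeds_into_complete_multipartite[OF G c \<open>V \<noteq> {}\<close>, of P ?G]) (use P in blast)+
      have "inj_on \<iota> (\<Union>E)"
        by (rule inj_on_subset[OF \<iota>(1)]) (use G in \<open>auto simp: simple_graph_def\<close>)
      from contains_s_copy_if_big_pairs_contain[OF G H _ this \<iota>(2)] n free show False by simp
    qed
    then have few: "w * card ?G \<le> w * ((1 - 1 / r + \<eta>') * (n choose 2))"
      using w0 by (intro mult_left_mono) auto
    have "real (card H + (q - q div 2)\<^sup>2 * (n choose 2))
        \<le> real (q\<^sup>2 * (n choose 2) + (q - q div 2)\<^sup>2 * card ?G)"
      using card_q_graph_le[OF H] by (rule of_nat_mono)
    then have "card H + w * (n choose 2) \<le> real q ^ 2 * (n choose 2) + w * card ?G"
      by (simp add: w_def)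
    with few have "card H \<le> (real q ^ 2 - w / r + w * \<eta>') * (n choose 2)"
      by (simp add: algebra_simps)
    also have "\<dots> \<le> (real q ^ 2 - w / r + \<eta>) * (n choose 2)"
      using \<eta>'(2) by (intro mult_right_mono) auto
    finally show "real (card H) \<le> (real q ^ 2 - real (q - q div 2) ^ 2 / r + \<eta>) * (n choose 2)"
      by (simp add: w_def)
  qed
qed

section \<open>The extremal number\<close>

lemma ex_number_attained:
  assumes "simple_graph V E" "E \<noteq> {}"
  obtains H where "H \<subseteq> q_edges q n" "\<not> contains_s_copy q n (q + 1) V E H" "ex_number n V E q = card H"
    "\<And>H'. H' \<subseteq> q_edges q n \<Longrightarrow> \<not> contains_s_copy q n (q + 1) V E H' \<Longrightarrow> card H' \<le> ex_number n V E q"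
proof -
  let ?S = "{card H | H. H \<subseteq> q_edges q n \<and> \<not> contains_s_copy q n (q + 1) V E H}"
  have "?S \<subseteq> card ` Pow (q_edges q n)" by auto
  then have fin: "finite ?S" using finite_q_edges finite_subset by blast
  have "finite E" using assms(1)
    by (intro finite_subset[of E "Pow V"]) (auto simp: simple_graph_def)
  then have "card E \<noteq> 0" using assms(2) by simp
  then have "\<not> contains_s_copy q n (q + 1) V E {}"
    by (auto simp: contains_s_copy_def s_copy_def s_copy_no_isolated_def)
  then have "?S \<noteq> {}" by blast
  from Max_in[OF fin this] obtain H where "H \<subseteq> q_edges q n" "\<not> contains_s_copy q n (q + 1) V E H"
    "ex_number n V E q = card H" unfolding ex_number_def by auto
  moreover have "card H' \<le> ex_number n V E q"
    if "H' \<subseteq> q_edges q n" "\<not> contains_s_copy q n (q + 1) V E H'" for H'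
    unfolding ex_number_def using that by (intro Max_ge fin) blast
  ultimately show ?thesis by (rule that)
qed

lemma ceiling_half: "real q - real_of_int \<lceil>(real q + 1) / 2\<rceil> + 1 = real (q - q div 2)"
proof -
  define p where "p = q div 2"
  have "q = 2 * p \<or> q = 2 * p + 1" unfolding p_def by linarith
  then have "real q = 2 * real p \<or> real q = 2 * real p + 1" by auto
  then have "\<lceil>(real q + 1) / 2\<rceil> = int p + 1" by (intro ceiling_unique) auto
  moreover have "p \<le> q" by (simp add: p_def)
  ultimately show ?thesis by (simp add: of_nat_diff flip: p_def)
qed

theorem lemma2p5:
  fixes V C :: "'a set" and E :: "'a set set" and q :: nat
  assumes "q \<ge> 1"
    and "simple_graph V E"
    and "C \<in> components V E"
    and "card C < card (induced_edges E C)"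
  shows "(\<exists>\<epsilon> :: nat \<Rightarrow> real. \<epsilon> \<in> o(\<lambda>_. 1) \<and>
           (\<forall>n\<ge>1. real (ex_number n V E q) \<ge>
             ((real q)\<^sup>2
               - (real q - real_of_int \<lceil>(real q + 1) / 2\<rceil> + 1)\<^sup>2
                 * (1 / (real (robust_chromatic_number V E) - 1))
               + \<epsilon> n) * real (n choose 2)))
       \<and> (chromatic_number V E = robust_chromatic_number V E \<longrightarrow>
          (\<exists>\<epsilon> :: nat \<Rightarrow> real. \<epsilon> \<in> o(\<lambda>_. 1) \<and>
           (\<forall>n\<ge>1. real (ex_number n V E q) =
             ((real q)\<^sup>2
               - (real q - real_of_int \<lceil>(real q + 1) / 2\<rceil> + 1)\<^sup>2
                 * (1 / (real (chromatic_number V E) - 1))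
               + \<epsilon> n) * real (n choose 2))))"
proof -
  note G = \<open>simple_graph V E\<close>
  have "C \<subseteq> V" using assms(3) by (auto simp: components_def)
  from robust_chromatic_number_ge_2[OF G this assms(4)] obtain r where
    r: "r \<ge> 1" "robust_chromatic_number V E = Suc r"
    by (metis Suc_le_D Suc_le_mono one_add_one plus_1_eq_Suc)
  have "E \<noteq> {}" using assms(4) by (auto simp: induced_edges_def)
  define \<gamma> where "\<gamma> = real q ^ 2 - real (q - q div 2) ^ 2 / r"
  have \<gamma>: "(real q)\<^sup>2 - (real q - real_of_int \<lceil>(real q + 1) / 2\<rceil> + 1)\<^sup>2 * (1 / (real (Suc r) - 1)) = \<gamma>"
    unfolding ceiling_half by (simp add: \<gamma>_def)
  have lower: "\<gamma> * (n choose 2) \<le> ex_number n V E q" for n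
  proof -
    obtain H where max: "\<And>H'. H' \<subseteq> q_edges q n \<Longrightarrow> \<not> contains_s_copy q n (q + 1) V E H' \<Longrightarrow> card H' \<le> ex_number n V E q"
      by (rule ex_number_attained[OF G \<open>E \<noteq> {}\<close>, of q n]) blast
    have "card (turan_q_graph q r n) \<le> ex_number n V E q"
      by (rule max, force simp: turan_q_graph_def) (rule turan_q_graph_copy_free[OF G], use r in auto)
    then show ?thesis using card_turan_q_graph[OF r(1), of q n] unfolding \<gamma>_def by linarith
  qed
  show ?thesis unfolding r(2)
  proof (intro conjI impI)
    show "\<exists>\<epsilon> :: nat \<Rightarrow> real. \<epsilon> \<in> o(\<lambda>_. 1) \<and> (\<forall>n\<ge>1. real (ex_number n V E q) \<ge>
        ((real q)\<^sup>2 - (real q - real_of_int \<lceil>(real q + 1) / 2\<rceil> + 1)\<^sup>2 * (1 / (real (Suc r) - 1)) + \<epsilon> n)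
          * real (n choose 2))"
      unfolding \<gamma> using lower by (intro exI[of _ "\<lambda>_. 0"]) auto
  next
    assume chi: "chromatic_number V E = Suc r"
    define \<epsilon> where "\<epsilon> n = real (ex_number n V E q) / (n choose 2) - \<gamma>" for n
    have "\<epsilon> \<longlonglongrightarrow> 0"
    proof (rule LIMSEQ_I)
      fix \<eta> :: real assume "\<eta> > 0"
      then have "\<eta> / 2 > 0" by simp
      from copy_free_card_le[OF G chi r(1) this, of q] obtain N where N:
        "\<forall>n\<ge>N. \<forall>H. H \<subseteq> q_edges q n \<longrightarrow> \<not> contains_s_copy q n (q + 1) V E H \<longrightarrow>
          real (card H) \<le> (\<gamma> + \<eta> / 2) * (n choose 2)" unfolding \<gamma>_def ..
      show "\<exists>N. \<forall>n\<ge>N. norm (\<epsilon> n - 0) < \<eta>"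
      proof (intro exI[of _ "max N 2"] allI impI)
        fix n assume n: "max N 2 \<le> n"
        then have pos: "real (n choose 2) > 0" by (simp add: zero_less_binomial)
        obtain H where "H \<subseteq> q_edges q n" "\<not> contains_s_copy q n (q + 1) V E H" "ex_number n V E q = card H"
          by (rule ex_number_attained[OF G \<open>E \<noteq> {}\<close>, of q n]) blast
        then have "real (ex_number n V E q) \<le> (\<gamma> + \<eta> / 2) * (n choose 2)" using N n by simp
        then have "\<epsilon> n \<le> \<eta> / 2" using pos by (simp add: \<epsilon>_def field_simps)
        moreover have "0 \<le> \<epsilon> n" using lower[of n] pos by (simp add: \<epsilon>_def field_simps)
        ultimately show "norm (\<epsilon> n - 0) < \<eta>" using \<open>\<eta> > 0\<close> by simp
      qed
    qed
    then have small: "\<epsilon> \<in> o(\<lambda>_. 1)" by (intro smalloI_tendsto) auto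
    have eq: "real (ex_number n V E q) = (\<gamma> + \<epsilon> n) * (n choose 2)" for n
    proof (cases "n choose 2 = 0")
      case True
      obtain H where "H \<subseteq> q_edges q n" "ex_number n V E q = card H"
        by (rule ex_number_attained[OF G \<open>E \<noteq> {}\<close>, of q n]) blast
      then have "ex_number n V E q \<le> q\<^sup>2 * (n choose 2)"
        using card_mono[OF finite_q_edges] by (metis card_q_edges)
      then show ?thesis using True by simp
    next
      case False
      then show ?thesis by (simp add: \<epsilon>_def)
    qed
    show "\<exists>\<epsilon> :: nat \<Rightarrow> real. \<epsilon> \<in> o(\<lambda>_. 1) \<and> (\<forall>n\<ge>1. real (ex_number n V E q) =
        ((real q)\<^sup>2 - (real q - real_of_int \<lceil>(real q + 1) / 2\<rceil> + 1)\<^sup>2 * (1 / (real (chromatic_number V E) - 1)) + \<epsilon> n)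
          * real (n choose 2))"
      unfolding chi \<gamma> using small eq by blast
  qed
qed

end
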